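(* Let $\mathcal D_0$ be a positively oriented Descartes configuration and consider the geometric Apollonian super-packing generated by $\mathcal D_0$. For each integer $k\ge1$, the circles of the super-packing having nesting depth exactly $k$ (with respect to $\mathcal D_0$) have pairwise disjoint interiors. Moreover, the set of circles of nesting depth exactly $k$ is a union of (countably many) sets, each of which consists of all circles of some geometric Apollonian packing contained in the super-packing except its bounding circle, and this omitted bounding circle has nesting depth $k-1$.
   Context: Circles are taken in $\hat{\mathbb C}=\mathbb R^2\cup\{\infty\}$; lines count as circles. A Descartes configuration is a set of four mutually tangent circles with disjoint interiors (interior of a circle: one of its two complementary open regions; of a line: one of its open half-planes). An ordered, oriented Descartes configuration $\mathcal D=(C_1,\dots,C_4)$ is such a configuration with an ordering and a total orientation (positive if the interiors are the disjoint ones, negative if every interior is replaced by the complementary region). Signed curvature: $1/r$ if the interior is the bounded disk of radius $r$, $-1/r$ if the interior is unbounded, $0$ for a line (signs reversed for negative orientation). The augmented curvature-center coordinate matrix $W_{\mathcal D}$ has $i$-th row $(\bar b_i,b_i,b_ix_i,b_iy_i)$ with $(x_i,y_i)$ the center, $\bar b_i=b_i(x_i^2+y_i^2)-1/b_i$ (for a line: $(2p\cdot n,0,n_x,n_y)$, $n$ the unit normal pointing into the interior, $p$ a point of the line); it determines $\mathcal D$. Let $S_i$ be the $4\times4$ integer matrix equal to the identity except that row $i$ has $-1$ in position $i$ and $2$ elsewhere, and $S_i^\perp=S_i^T$. The Apollonian group is $\mathcal A=\langle S_1,\dots,S_4\rangle$ and the super-Apollonian group is $\mathcal A^S=\langle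 S_1,\dots,S_4,S_1^\perp,\dots,S_4^\perp\rangle$, acting by $W_{U[\mathcal D]}=UW_{\mathcal D}$. The geometric Apollonian packing generated by $\mathcal D$ is the set of circles in configurations of $\mathcal A[\mathcal D]$; its bounding circle (when present) is a circle of the packing such that all circles of the packing lie in the closed disk it bounds. The geometric super-packing generated by $\mathcal D_0$ is the set of circles in configurations of $\mathcal A^S[\mathcal D_0]$. The nesting depth of a circle $C$ of the super-packing (with respect to $\mathcal D_0$) is the number of circles $C'\neq C$ of the super-packing such that $C$ lies in the closure of the interior of $C'$, interiors being those induced by the positive orientation of $\mathcal D_0$ (the circles of nesting depth $0$ are exactly those of the Apollonian packing generated by $\mathcal D_0$). *)

theory Defs
  imports "HOL-Analysis.Analysis"
begin

text \<open>Oriented circles in the extended plane are parametrised by their augmented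
curvature-center coordinates w = (bbar, b, b x, b y) (a row of W), which must satisfy
- b * bbar + (b x)^2 + (b y)^2 = 1.  Points of the plane are complex numbers; the point
at infinity is handled explicitly where it matters (tangency of lines).\<close>

definition acc_bbar :: "real^4 \<Rightarrow> real" where "acc_bbar w = w $ 1"
definition acc_curv :: "real^4 \<Rightarrow> real" where "acc_curv w = w $ 2"
definition acc_x :: "real^4 \<Rightarrow> real" where "acc_x w = w $ 3"
definition acc_y :: "real^4 \<Rightarrow> real" where "acc_y w = w $ 4"

definition valid_acc :: "real^4 \<Rightarrow> bool" where
  "valid_acc w \<longleftrightarrow> - acc_curv w * acc_bbar w + (acc_x w)^2 + (acc_y w)^2 = 1"

definition acc_center :: "real^4 \<Rightarrow> complex" where
  "acc_center w = Complex (acc_x w / acc_curv w) (acc_y w / acc_curv w)"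

definition circ_set :: "real^4 \<Rightarrow> complex set" where
  "circ_set w = (if acc_curv w = 0
     then {z. Re z * acc_x w + Im z * acc_y w = acc_bbar w / 2}
     else sphere (acc_center w) (1 / \<bar>acc_curv w\<bar>))"

definition circ_int :: "real^4 \<Rightarrow> complex set" where
  "circ_int w = (if acc_curv w = 0
     then {z. Re z * acc_x w + Im z * acc_y w > acc_bbar w / 2}
     else if acc_curv w > 0 then ball (acc_center w) (1 / acc_curv w)
     else - cball (acc_center w) (1 / \<bar>acc_curv w\<bar>))"

text \<open>Tangency in the extended plane: exactly one common point; two lines always
share the point at infinity.\<close>
definition tangent :: "real^4 \<Rightarrow> real^4 \<Rightarrow> bool" where
  "tangent v w \<longleftrightarrow> (if acc_curv v = 0 \<and> acc_curv w = 0
     then circ_set v \<inter> circ_set w = {}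
     else (\<exists>!z. z \<in> circ_set v \<inter> circ_set w))"

definition pos_descartes :: "real^4^4 \<Rightarrow> bool" where
  "pos_descartes W \<longleftrightarrow> (\<forall>i. valid_acc (W $ i)) \<and>
     (\<forall>i j. i \<noteq> j \<longrightarrow> tangent (W $ i) (W $ j) \<and> circ_int (W $ i) \<inter> circ_int (W $ j) = {})"

definition S_mat :: "4 \<Rightarrow> real^4^4" where
  "S_mat i = (\<chi> r c. if r = i then (if c = i then -1 else 2) else (if r = c then 1 else 0))"

inductive_set mat_group :: "(real^4^4) set \<Rightarrow> (real^4^4) set" for G where
  one: "mat 1 \<in> mat_group G"
| gen: "g \<in> G \<Longrightarrow> g \<in> mat_group G"
| mult: "U \<in> mat_group G \<Longrightarrow> V \<in> mat_group G \<Longrightarrow> U ** V \<in> mat_group G"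
| inv: "U \<in> mat_group G \<Longrightarrow> matrix_inv U \<in> mat_group G"

definition apollonian_group :: "(real^4^4) set" where
  "apollonian_group = mat_group (range S_mat)"

definition super_apollonian_group :: "(real^4^4) set" where
  "super_apollonian_group = mat_group (range S_mat \<union> range (\<lambda>i. transpose (S_mat i)))"

definition packing_circles :: "real^4^4 \<Rightarrow> complex set set" where
  "packing_circles W = {circ_set ((U ** W) $ i) | U i. U \<in> apollonian_group}"

definition super_circles :: "real^4^4 \<Rightarrow> complex set set" where
  "super_circles W0 = {circ_set ((U ** W0) $ i) | U i. U \<in> super_apollonian_group}"

text \<open>Interior of a circle of the super-packing induced by the positive orientation of
D0: the complementary region of the circle meeting no circle of the Apollonian packing
generated by D0 (for circles of that packing this is the interior given by D0).\<close>
definition sp_int :: "real^4^4 \<Rightarrow> complex set \<Rightarrow> complex set" where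
  "sp_int W0 C = (THE R. (\<exists>w. valid_acc w \<and> circ_set w = C \<and> R = circ_int w) \<and>
                         R \<inter> \<Union>(packing_circles W0) = {})"

definition has_depth :: "real^4^4 \<Rightarrow> complex set \<Rightarrow> nat \<Rightarrow> bool" where
  "has_depth W0 C k \<longleftrightarrow>
     (let N = {C'. C' \<in> super_circles W0 \<and> C' \<noteq> C \<and> C \<subseteq> closure (sp_int W0 C')}
      in finite N \<and> card N = k)"

definition bounding_circle :: "real^4^4 \<Rightarrow> real^4^4 \<Rightarrow> complex set \<Rightarrow> bool" where
  "bounding_circle W0 W B \<longleftrightarrow> B \<in> packing_circles W \<and>
     (\<forall>C \<in> packing_circles W. C \<subseteq> closure (sp_int W0 B))"

end

theory Submission
  imports Defs
begin

text \<open>Augmented curvature-center coordinates identify oriented circles with the unit spacelike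
  vectors of a Lorentz space, and a configuration is positive iff distinct rows have product -1 and
  future-pointing (null) sum. The super-Apollonian group preserves the integer combinations of the
  rows with odd coefficient sum, and products of such vectors are odd integers. Hence products of
  two circles of the super-packing never lie strictly between -1 and 1: no two circles cross. The
  rows of a configuration cut out, together with their duals, an ideal octahedron; the sign
  of the product with its center decides on which side of a circle the configuration lies. A step
  of the Apollonian group crosses no circle of the super-packing, a dual step crosses exactly one,
  so the depth of a circle is the number of circles that separate a configuration containing it from
  the initial one. If all circles of a packing separated from the initial configuration were
  oriented away from the latter, the configuration with the least sum of row heights would have all
  heights equal to 1, which is impossible; the circle oriented towards it is the bounding circle.\<close>

section \<open>The Lorentz form\<close>

text \<open>Polarisation of the quadratic form in \<open>valid_acc\<close>. Its signature is (3,1):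
  the first two coordinates are null coordinates, the last two are spacelike.\<close>

definition lor :: "real^4 \<Rightarrow> real^4 \<Rightarrow> real" where
  "lor v w = v$3 * w$3 + v$4 * w$4 - (v$1 * w$2 + v$2 * w$1) / 2"

lemma lor_commute: "lor v w = lor w v"
  by (simp add: lor_def algebra_simps)

lemma bilinear_lor: "bilinear lor"
  unfolding bilinear_def by (intro conjI allI linearI) (simp_all add: lor_def field_simps)

lemmas lor_simps = bilinear_ladd[OF bilinear_lor] bilinear_radd[OF bilinear_lor]
  bilinear_lsub[OF bilinear_lor] bilinear_rsub[OF bilinear_lor]
  bilinear_lneg[OF bilinear_lor] bilinear_rneg[OF bilinear_lor]
  bilinear_lmul[OF bilinear_lor] bilinear_rmul[OF bilinear_lor]
  bilinear_lzero[OF bilinear_lor] bilinear_rzero[OF bilinear_lor]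

lemma lor_sum_right: "lor v (sum f A) = (\<Sum>i\<in>A. lor v (f i))"
  using linear_sum[of "lor v" f A] bilinear_lor by (auto simp: bilinear_def)

lemma valid_acc_iff: "valid_acc w \<longleftrightarrow> lor w w = 1"
  by (simp add: valid_acc_def lor_def acc_bbar_def acc_curv_def acc_x_def acc_y_def power2_eq_square
      algebra_simps)

text \<open>For circles \<open>u\<close>, \<open>v\<close>, \<open>future (u + v)\<close> means that the interiors are disjoint, and
  \<open>future (u - v)\<close> that the interior of \<open>u\<close> is contained in that of \<open>v\<close>.\<close>

definition future :: "real^4 \<Rightarrow> bool" where
  "future a \<longleftrightarrow> lor a a \<le> 0 \<and> 0 \<le> a$1 \<and> 0 \<le> a$2"

text \<open>Cauchy-Schwarz followed by the inequality of arithmetic and geometric means for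
  \<open>p * s\<close> and \<open>q * r\<close>. In null coordinates this is what makes the product
  of two future vectors nonpositive.\<close>

lemma abs_product_sum_le:
  fixes a b c d p q r s :: real
  assumes "a\<^sup>2 + b\<^sup>2 \<le> p * q" "c\<^sup>2 + d\<^sup>2 \<le> r * s" "0 \<le> p" "0 \<le> q" "0 \<le> r" "0 \<le> s"
  shows "\<bar>a * c + b * d\<bar> \<le> (p * s + q * r) / 2"
proof -
  have "(a * c + b * d)\<^sup>2 \<le> (a\<^sup>2 + b\<^sup>2) * (c\<^sup>2 + d\<^sup>2)"
    using zero_le_power2[of "a * d - b * c"] by (simp add: power2_eq_square algebra_simps)
  also have "\<dots> \<le> (p * q) * (r * s)"
    using assms by (intro mult_mono) auto
  also have "\<dots> \<le> ((p * s + q * r) / 2)\<^sup>2"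
    using zero_le_power2[of "p * s - q * r"] by (simp add: power2_eq_square field_simps)
  finally have "\<bar>a * c + b * d\<bar> \<le> \<bar>(p * s + q * r) / 2\<bar>"
    by (rule abs_le_square_iff[THEN iffD2])
  then show ?thesis using assms by simp
qed

lemma lor_self_le_iff: "lor a a \<le> 0 \<longleftrightarrow> (a$3)\<^sup>2 + (a$4)\<^sup>2 \<le> a$1 * a$2"
  by (simp add: lor_def power2_eq_square algebra_simps)

lemma lor_future_le:
  assumes "future a" "future b" shows "lor a b \<le> 0"
proof -
  have "\<bar>a$3 * b$3 + a$4 * b$4\<bar> \<le> (a$1 * b$2 + a$2 * b$1) / 2"
    using assms by (intro abs_product_sum_le) (auto simp: future_def lor_self_le_iff)
  then show ?thesis unfolding lor_def by linarith
qed

lemma future_add: "future a \<Longrightarrow> future b \<Longrightarrow> future (a + b)"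
  using lor_future_le[of a b] lor_commute[of a b] by (auto simp: future_def lor_simps)

lemma future_antisym:
  assumes "future a" "future (- a)" shows "a = 0"
proof -
  have "a$1 = 0" "a$2 = 0" "(a$3)\<^sup>2 + (a$4)\<^sup>2 \<le> 0"
    using assms by (auto simp: future_def lor_self_le_iff)
  then have "a$3 = 0" "a$4 = 0"
    by (simp_all add: sum_power2_le_zero_iff)
  then show ?thesis using \<open>a$1 = 0\<close> \<open>a$2 = 0\<close> by (simp add: vec_eq_iff forall_4)
qed

lemma future_or_neg:
  assumes "lor a a \<le> 0" shows "future a \<or> future (- a)"
proof -
  have "0 \<le> a$1 * a$2"
    using assms unfolding lor_self_le_iff by (smt (verit) zero_le_power2)
  then show ?thesis using assms by (auto simp: future_def lor_simps zero_le_mult_iff)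
qed

text \<open>A causal vector lies in the future or the past cone; a negative product with a future
  vector rules out the past.\<close>

lemma future_if_lor_neg:
  assumes "lor a a \<le> 0" "future x" "lor a x < 0" shows "future a"
  using future_or_neg[OF assms(1)] lor_future_le[of "- a" x] assms by (auto simp: lor_simps)

lemma causal_orthogonal_timelike:
  assumes "lor a a \<le> 0" "lor x x < 0" "lor a x = 0" shows "a = 0"
proof -
  have main: "b = 0" if b: "future b" "future y" "lor y y < 0" "lor b y = 0" for b y :: "real^4"
  proof -
    have pos: "0 \<le> b$1" "0 \<le> b$2" and le: "(b$3)\<^sup>2 + (b$4)\<^sup>2 \<le> b$1 * b$2"
      using b(1) by (auto simp: future_def lor_self_le_iff)
    have yle: "(y$3)\<^sup>2 + (y$4)\<^sup>2 < y$1 * y$2"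
      using b(3) by (simp add: lor_def power2_eq_square algebra_simps)
    then have "0 < y$1 * y$2" by (smt (verit) zero_le_power2)
    moreover have "0 \<le> y$1" "0 \<le> y$2" using b(2) by (auto simp: future_def)
    ultimately have ypos: "0 < y$1" "0 < y$2" by (auto simp: zero_less_mult_iff)
    \<comment> \<open>Lowering \<open>y$2\<close> to \<open>m\<close> makes \<open>y\<close> null
      but keeps it in the closed cone. The inequality for this smaller vector, compared with
      orthogonality to \<open>y\<close> itself, leaves no room for \<open>b$1 > 0\<close>.\<close>
    define m where "m = ((y$3)\<^sup>2 + (y$4)\<^sup>2) / y$1"
    have m: "0 \<le> m" "m < y$2" using yle ypos by (auto simp: m_def field_simps)
    have mm: "(y$3)\<^sup>2 + (y$4)\<^sup>2 \<le> y$1 * m" using ypos by (simp add: m_def)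
    have "\<bar>b$3 * y$3 + b$4 * y$4\<bar> \<le> (b$1 * m + b$2 * y$1) / 2"
      using abs_product_sum_le[OF le mm] pos m ypos by auto
    moreover have "b$3 * y$3 + b$4 * y$4 = (b$1 * y$2 + b$2 * y$1) / 2"
      using b(4) by (simp add: lor_def)
    ultimately have "b$1 * (y$2 - m) \<le> 0" by (simp add: algebra_simps abs_le_iff)
    then have b1: "b$1 = 0" using pos m by (smt (verit) mult_pos_pos)
    then have b34: "b$3 = 0" "b$4 = 0" using le by (auto simp: sum_power2_le_zero_iff)
    then have "b$2 = 0" using b(4) b1 ypos by (simp add: lor_def)
    then show ?thesis using b1 b34 by (simp add: vec_eq_iff forall_4)
  qed
  show ?thesis
    using future_or_neg[OF assms(1)] future_or_neg[of x] main[of a x] main[of "- a" x]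
      main[of a "- x"] main[of "- a" "- x"] assms by (auto simp: lor_simps)
qed

section \<open>Circles and tangency\<close>

text \<open>The plane embedded in the light cone, normalised to second coordinate 1. The product
  with a circle vanishes on the circle and is positive exactly in its interior. Infinity would be
  the direction (1,0,0,0), which is not in the range.\<close>

definition null_pt :: "complex \<Rightarrow> real^4" where
  "null_pt z = vector [(Re z)\<^sup>2 + (Im z)\<^sup>2, 1, Re z, Im z]"

lemma null_pt_nth [simp]:
  "null_pt z $ 1 = (Re z)\<^sup>2 + (Im z)\<^sup>2" "null_pt z $ 2 = 1" "null_pt z $ 3 = Re z" "null_pt z $ 4 = Im z"
  by (simp_all add: null_pt_def vector_def)

lemma lor_null_pt_le:
  assumes "future a" shows "lor a (null_pt z) \<le> 0"
  by (rule lor_future_le[OF assms]) (auto simp: future_def lor_def power2_eq_square)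

text \<open>The product is the power of the point with respect to the circle, scaled by minus half
  the signed curvature; the sign of the curvature encodes the orientation.\<close>

lemma lor_null_pt:
  assumes "lor w w = 1" "w$2 \<noteq> 0"
  shows "lor w (null_pt z) = - (w$2 / 2) * ((dist (acc_center w) z)\<^sup>2 - (1 / w$2)\<^sup>2)"
proof -
  have d: "(dist (acc_center w) z)\<^sup>2 = (w$3 / w$2 - Re z)\<^sup>2 + (w$4 / w$2 - Im z)\<^sup>2"
    by (simp add: dist_norm cmod_power2 acc_center_def acc_x_def acc_y_def acc_curv_def)
  have w1: "w$1 = ((w$3)\<^sup>2 + (w$4)\<^sup>2 - 1) / w$2"
    using assms by (simp add: lor_def field_simps power2_eq_square)
  show ?thesis unfolding d lor_def w1 using assms(2)
    by (simp add: field_simps power2_eq_square)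
qed

lemma circ_set_eq:
  assumes "lor w w = 1" shows "circ_set w = {z. lor w (null_pt z) = 0}"
proof (cases "w$2 = 0")
  case True
  then show ?thesis
    by (auto simp: circ_set_def acc_curv_def acc_bbar_def acc_x_def acc_y_def lor_def algebra_simps)
next
  case False
  have "(dist (acc_center w) z = 1 / \<bar>w$2\<bar>) \<longleftrightarrow> (dist (acc_center w) z)\<^sup>2 = (1 / w$2)\<^sup>2" for z
    using power2_eq_iff_nonneg[of "dist (acc_center w) z" "1 / \<bar>w$2\<bar>"] by (simp add: power_divide)
  then show ?thesis
    using False lor_null_pt[OF assms False] by (auto simp: circ_set_def acc_curv_def)
qed

lemma circ_int_eq:
  assumes "lor w w = 1" shows "circ_int w = {z. 0 < lor w (null_pt z)}"
proof -
  consider "w$2 = 0" | "0 < w$2" | "w$2 < 0" by linarith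
  then show ?thesis
  proof cases
    case 1
    then show ?thesis
      by (auto simp: circ_int_def acc_curv_def acc_bbar_def acc_x_def acc_y_def lor_def algebra_simps)
  next
    case 2
    have "dist (acc_center w) z < 1 / w$2 \<longleftrightarrow> (dist (acc_center w) z)\<^sup>2 < (1 / w$2)\<^sup>2" for z
      using power_mono_iff[of "1 / w$2" "dist (acc_center w) z" 2] 2 by (simp flip: not_le)
    then show ?thesis
      using 2 lor_null_pt[OF assms] by (auto simp: circ_int_def acc_curv_def mult_less_0_iff)
  next
    case 3
    have "1 / - w$2 < dist (acc_center w) z \<longleftrightarrow> (1 / w$2)\<^sup>2 < (dist (acc_center w) z)\<^sup>2" for z
      using power_mono_iff[of "dist (acc_center w) z" "1 / - w$2" 2] 3
      by (simp add: power_divide flip: not_le)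
    moreover have "z \<in> circ_int w \<longleftrightarrow> 1 / - w$2 < dist (acc_center w) z" for z
      using 3 by (auto simp: circ_int_def acc_curv_def)
    moreover have "0 < lor w (null_pt z) \<longleftrightarrow> (1 / w$2)\<^sup>2 < (dist (acc_center w) z)\<^sup>2" for z
      using 3 lor_null_pt[OF assms, of z] by (auto simp: mult_less_0_iff)
    ultimately show ?thesis by blast
  qed
qed

lemma closure_circ_int:
  assumes "lor w w = 1" shows "circ_set w \<subseteq> closure (circ_int w)"
proof -
  consider "w$2 = 0" | "0 < w$2" | "w$2 < 0" by linarith
  then show ?thesis
  proof cases
    case 1
    have n: "Complex (w$3) (w$4) \<noteq> 0"
      using assms 1 by (auto simp: lor_def complex_eq_iff)
    have "circ_int w = {z. w$1 / 2 < Complex (w$3) (w$4) \<bullet> z}"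
      using 1 by (auto simp: circ_int_def acc_curv_def acc_bbar_def acc_x_def acc_y_def
          inner_complex_def mult.commute)
    then have "closure (circ_int w) = {z. w$1 / 2 \<le> Complex (w$3) (w$4) \<bullet> z}"
      using closure_halfspace_gt[OF n, of "w$1 / 2"] by (simp add: inner_commute)
    moreover have "circ_set w = {z. Complex (w$3) (w$4) \<bullet> z = w$1 / 2}"
      using 1 by (auto simp: circ_set_def acc_curv_def acc_bbar_def acc_x_def acc_y_def
          inner_complex_def mult.commute)
    ultimately show ?thesis by auto
  next
    case 2
    then show ?thesis by (auto simp: circ_set_def circ_int_def acc_curv_def)
  next
    case 3
    then show ?thesis by (auto simp: circ_set_def circ_int_def acc_curv_def closure_complement)
  qed
qed

lemma closure_circ_int_le:
  assumes "lor w w = 1" shows "closure (circ_int w) \<subseteq> {z. 0 \<le> lor w (null_pt z)}"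
proof (rule closure_minimal)
  show "circ_int w \<subseteq> {z. 0 \<le> lor w (null_pt z)}" using circ_int_eq[OF assms] by auto
  have "continuous_on UNIV (\<lambda>z. lor w (null_pt z))"
    unfolding lor_def by (simp, intro continuous_intros, auto)
  then show "closed {z. 0 \<le> lor w (null_pt z)}"
    by (intro closed_Collect_le) auto
qed

lemma lor_null_pt_expand:
  "lor w (null_pt z) = w$3 * Re z + w$4 * Im z - (w$1 + w$2 * ((Re z)\<^sup>2 + (Im z)\<^sup>2)) / 2"
  by (simp add: lor_def algebra_simps)

text \<open>The equation of \<open>w\<close> vanishes at three chosen points if \<open>v\<close> is
  a line and at four if it is a circle. These already force \<open>w\<close> to be a multiple of
  \<open>v\<close>, and both are unit vectors.\<close>

lemma circ_set_subset_cases: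
  assumes v: "lor v v = 1" and w: "lor w w = 1" and sub: "circ_set v \<subseteq> circ_set w"
  shows "w = v \<or> w = - v"
proof -
  have "\<exists>k. w = k *\<^sub>R v"
  proof (cases "v$2 = 0")
    case True
    then have n: "v$3 * v$3 + v$4 * v$4 = 1" using v by (simp add: lor_def)
    \<comment> \<open>Parametrisation of the line by arc length, starting at the foot of the
      perpendicular from the origin; the values 0, 1 and -1 of \<open>t\<close> suffice
      below.\<close>
    define p where "p t = Complex (v$1 / 2 * v$3 - t * v$4) (v$1 / 2 * v$4 + t * v$3)" for t
    have norm_p: "(Re (p t))\<^sup>2 + (Im (p t))\<^sup>2 = ((v$1)\<^sup>2 / 4 + t\<^sup>2) * (v$3 * v$3 + v$4 * v$4)" for t
      by (simp add: p_def power2_eq_square field_simps)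
    have lin: "Re (p t) * v$3 + Im (p t) * v$4 = v$1 / 2 * (v$3 * v$3 + v$4 * v$4)" for t
      by (simp add: p_def algebra_simps)
    have p_mem: "p t \<in> circ_set v" for t
      unfolding circ_set_eq[OF v] using True lin[of t] n by (simp add: lor_null_pt_expand algebra_simps)
    have E: "w$3 * Re (p t) + w$4 * Im (p t) - (w$1 + w$2 * ((v$1)\<^sup>2 / 4 + t\<^sup>2)) / 2 = 0" for t
    proof -
      have "lor w (null_pt (p t)) = 0" using p_mem sub circ_set_eq[OF w] by blast
      then show ?thesis by (simp add: lor_null_pt_expand norm_p n)
    qed
    note E' = E[of 0, unfolded p_def, simplified] E[of 1, unfolded p_def, simplified]
      E[of "-1", unfolded p_def, simplified]
    have w2: "w$2 = 0" using E' by (simp add: algebra_simps)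
    have cross: "w$3 * v$4 = w$4 * v$3" using E' by (simp add: algebra_simps)
    define k where "k = w$3 * v$3 + w$4 * v$4"
    have "k * v$3 = w$3 * (v$3 * v$3) + v$4 * (w$4 * v$3)" "k * v$4 = v$3 * (w$3 * v$4) + w$4 * (v$4 * v$4)"
      by (simp_all add: k_def algebra_simps)
    then have "k * v$3 = w$3 * (v$3 * v$3 + v$4 * v$4)" "k * v$4 = w$4 * (v$3 * v$3 + v$4 * v$4)"
      by (simp_all add: cross[symmetric]) (simp_all add: cross algebra_simps)
    moreover have "w$1 = k * v$1" using E'(1) w2 by (simp add: k_def algebra_simps)
    ultimately have "w = k *\<^sub>R v" using n w2 True by (simp add: vec_eq_iff forall_4)
    then show ?thesis by blast
  next
    case False
    define cx where "cx = v$3 / v$2"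
    define cy where "cy = v$4 / v$2"
    define r where "r = 1 / \<bar>v$2\<bar>"
    have r: "r > 0" using False by (simp add: r_def)
    have mem: "acc_center v + p \<in> circ_set v" if "norm p = r" for p
      using that False by (simp add: circ_set_def acc_curv_def r_def dist_norm)
    \<comment> \<open>Stated for arbitrary \<open>u\<close> because it is applied to
      \<open>w\<close> and to \<open>v\<close> itself: both are their second coordinate times one
      vector that depends only on the circle.\<close>
    have rel: "u$3 = u$2 * cx \<and> u$4 = u$2 * cy \<and> u$1 = u$2 * (cx\<^sup>2 + cy\<^sup>2 - r\<^sup>2)"
      if u: "lor u u = 1" "circ_set v \<subseteq> circ_set u" for u
    proof -
      have E: "u$3 * (cx + a) + u$4 * (cy + b) - (u$1 + u$2 * ((cx + a)\<^sup>2 + (cy + b)\<^sup>2)) / 2 = 0"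
        if "norm (Complex a b) = r" for a b
        using mem[OF that] u(2) unfolding circ_set_eq[OF u(1)]
        by (auto simp: lor_null_pt_expand acc_center_def acc_curv_def acc_x_def acc_y_def cx_def cy_def)
      have n: "norm (Complex r 0) = r" "norm (Complex (- r) 0) = r" "norm (Complex 0 r) = r"
        "norm (Complex 0 (- r)) = r" using r by (simp_all add: complex_norm)
      note E' = n[THEN E]
      have "r * (u$3 - u$2 * cx) = 0" "r * (u$4 - u$2 * cy) = 0"
        using E' by algebra+
      then have u34: "u$3 = u$2 * cx" "u$4 = u$2 * cy" using r by auto
      moreover have "u$1 = u$2 * (cx\<^sup>2 + cy\<^sup>2 - r\<^sup>2)"
        using E'(1) unfolding u34 by (simp add: power2_eq_square algebra_simps)
      ultimately show ?thesis by blast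
    qed
    have "w = (w$2 / v$2) *\<^sub>R v"
      using rel[OF v order_refl] rel[OF w sub] False by (simp add: vec_eq_iff forall_4)
    then show ?thesis by blast
  qed
  then obtain k where k: "w = k *\<^sub>R v" by blast
  then have "k * k = 1" using v w by (simp add: lor_simps)
  then have "k = 1 \<or> k = -1" by (simp add: square_eq_1_iff)
  then show ?thesis using k by auto
qed

lemma open_circ_int: "open (circ_int w)"
proof (cases "acc_curv w = 0")
  case True
  have "open {z. acc_bbar w / 2 < Re z * acc_x w + Im z * acc_y w}"
    by (intro open_Collect_less continuous_intros)
  then show ?thesis using True by (simp add: circ_int_def)
qed (auto simp: circ_int_def)

section \<open>Tangency and disjointness in terms of the Lorentz form\<close>

lemma disjoint_circ_int_boundary:
  assumes "lor v v = 1" "lor w w = 1" "circ_int v \<inter> circ_int w = {}" "z \<in> circ_set v"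
  shows "lor w (null_pt z) \<le> 0"
proof (rule ccontr)
  assume "\<not> ?thesis"
  then have "z \<in> circ_int w" using circ_int_eq[OF assms(2)] by auto
  moreover have "z \<in> closure (circ_int v)" using closure_circ_int[OF assms(1)] assms(4) by blast
  moreover have "circ_int w \<inter> closure (circ_int v) = {}"
    using assms(3) open_circ_int by (simp add: open_Int_closure_eq_empty Int_commute)
  ultimately show False by blast
qed

text \<open>If the sum of the two gradients at the common point were nonzero, a short move along it
  would enter both interiors. The squared norm of this sum is 2 (1 +
  \<open>lor v w\<close>).\<close>

lemma common_point_disjoint:
  assumes v: "lor v v = 1" and w: "lor w w = 1"
    and disj: "circ_int v \<inter> circ_int w = {}" and z: "z \<in> circ_set v" "z \<in> circ_set w"
  shows "lor v w = -1"
proof -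
  define gx where "gx u = u$3 - u$2 * Re z" for u :: "real^4"
  define gy where "gy u = u$4 - u$2 * Im z" for u :: "real^4"
  have zero: "lor v (null_pt z) = 0" "lor w (null_pt z) = 0"
    using z circ_set_eq v w by auto
  \<comment> \<open>At a common point the Lorentz form is the inner product of the gradients.\<close>
  have g: "gx u * gx t + gy u * gy t = lor u t"
    if "lor u (null_pt z) = 0" "lor t (null_pt z) = 0" for u t
  proof -
    have "gx u * gx t + gy u * gy t
        = lor u t - t$2 * lor u (null_pt z) - u$2 * lor t (null_pt z)"
      by (simp add: gx_def gy_def lor_def power2_eq_square field_simps)
    then show ?thesis using that by simp
  qed
  have N: "(gx v + gx w)\<^sup>2 + (gy v + gy w)\<^sup>2 = 2 * (1 + lor v w)"
    using g[OF zero(1) zero(1)] g[OF zero(2) zero(2)] g[OF zero] v w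
    by (simp add: power2_eq_square algebra_simps)
  have ge: "-1 \<le> lor v w"
    using sum_power2_ge_zero[of "gx v + gx w" "gy v + gy w"] unfolding N by simp
  \<comment> \<open>Small enough that the quadratic term, which enters through the factor
    \<open>1 - u$2 * e\<close>, cannot cancel the first-order gain for either circle.\<close>
  define e where "e = 1 / (1 + \<bar>v$2\<bar> + \<bar>w$2\<bar>)"
  have e: "e > 0" "v$2 * e < 1" "w$2 * e < 1" by (auto simp: e_def field_simps)
  define z' where "z' = Complex (Re z + e * (gx v + gx w)) (Im z + e * (gy v + gy w))"
  have val: "lor u (null_pt z') = e * (1 + lor v w) * (1 - u$2 * e)"
    if u: "gx u * (gx v + gx w) + gy u * (gy v + gy w) = 1 + lor v w" "lor u (null_pt z) = 0" for u
  proof -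
    have "lor u (null_pt z') = lor u (null_pt z) + e * (gx u * (gx v + gx w) + gy u * (gy v + gy w))
      - u$2 / 2 * e\<^sup>2 * ((gx v + gx w)\<^sup>2 + (gy v + gy w)\<^sup>2)"
      by (simp add: gx_def gy_def lor_def z'_def power2_eq_square field_simps)
    then show ?thesis unfolding u N by (simp add: power2_eq_square field_simps)
  qed
  have "lor v (null_pt z') = e * (1 + lor v w) * (1 - v$2 * e)"
    using g[OF zero(1) zero(1)] g[OF zero] v zero by (intro val) (simp_all add: algebra_simps)
  moreover have "lor w (null_pt z') = e * (1 + lor v w) * (1 - w$2 * e)"
    using g[OF zero(2) zero(2)] g[OF zero] w zero by (intro val) (simp_all add: algebra_simps)
  ultimately have "z' \<in> circ_int v \<inter> circ_int w" if "lor v w > -1"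
    using that e by (simp add: circ_int_eq v w)
  then show ?thesis using disj ge by force
qed

text \<open>Disjoint lines are parallel, and half-planes with equal normals would overlap far out
  along the normal, so the normals are opposite.\<close>

lemma disjoint_lines:
  assumes v: "lor v v = 1" and w: "lor w w = 1" and lines: "v$2 = 0" "w$2 = 0"
    and disj: "circ_int v \<inter> circ_int w = {}" "circ_set v \<inter> circ_set w = {}"
  shows "lor v w = -1"
proof -
  have n: "v$3 * v$3 + v$4 * v$4 = 1" "w$3 * w$3 + w$4 * w$4 = 1"
    and Q: "lor v w = v$3 * w$3 + v$4 * w$4"
    using v w lines by (simp_all add: lor_def)
  define d where "d = v$3 * w$4 - v$4 * w$3"
  have d0: "d = 0"
  proof (rule ccontr)
    assume d: "d \<noteq> 0"
    \<comment> \<open>Cramer's rule: the intersection point of two lines whose normals have nonzero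
      determinant \<open>d\<close>.\<close>
    define z where "z = Complex ((v$1 * w$4 - w$1 * v$4) / (2 * d)) ((v$3 * w$1 - w$3 * v$1) / (2 * d))"
    have "lor v (null_pt z) = v$1 * (d / d) / 2 - v$1 / 2"
      using lines by (simp add: lor_def z_def add_divide_distrib[symmetric]) (simp add: d_def field_simps)
    moreover have "lor w (null_pt z) = w$1 * (d / d) / 2 - w$1 / 2"
      using lines by (simp add: lor_def z_def add_divide_distrib[symmetric]) (simp add: d_def field_simps)
    ultimately have "z \<in> circ_set v \<inter> circ_set w" using d by (simp add: circ_set_eq v w)
    then show False using disj by blast
  qed
  have "(lor v w)\<^sup>2 + d\<^sup>2 = (v$3 * v$3 + v$4 * v$4) * (w$3 * w$3 + w$4 * w$4)"
    by (simp add: Q d_def power2_eq_square algebra_simps)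
  then have "(lor v w)\<^sup>2 = 1" using d0 n by simp
  moreover have "lor v w \<noteq> 1"
  proof
    assume 1: "lor v w = 1"
    have "(v$3 - w$3)\<^sup>2 + (v$4 - w$4)\<^sup>2 = 0"
      using n 1 Q by (simp add: power2_eq_square algebra_simps)
    then have eq: "w$3 = v$3" "w$4 = v$4" by (auto simp: sum_power2_eq_zero_iff)
    define t where "t = \<bar>v$1\<bar> + \<bar>w$1\<bar> + 1"
    have t: "v$1 / 2 < t" "w$1 / 2 < t" unfolding t_def by linarith+
    define z where "z = Complex (t * v$3) (t * v$4)"
    have "lor u (null_pt z) = t * (v$3 * v$3 + v$4 * v$4) - u$1 / 2" if "u$2 = 0" "u$3 = v$3" "u$4 = v$4" for u
      using that by (simp add: lor_def z_def algebra_simps)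
    then have "z \<in> circ_int v \<inter> circ_int w"
      using lines eq n t by (simp add: circ_int_eq v w)
    then show False using disj by blast
  qed
  ultimately show ?thesis by (simp add: power2_eq_1_iff)
qed

lemma tangent_disjoint_lor:
  assumes v: "lor v v = 1" and w: "lor w w = 1"
    and tan: "tangent v w" and disj: "circ_int v \<inter> circ_int w = {}"
  shows "lor v w = -1" "future (v + w)"
proof -
  show Q: "lor v w = -1"
  proof (cases "v$2 = 0 \<and> w$2 = 0")
    case True
    then show ?thesis using tan disjoint_lines[OF v w _ _ disj] by (simp add: tangent_def acc_curv_def)
  next
    case False
    then obtain z where "z \<in> circ_set v" "z \<in> circ_set w"
      using tan by (auto simp: tangent_def acc_curv_def)
    then show ?thesis using common_point_disjoint[OF v w disj] by blast
  qed
  have "lor (v + w) (v + w) \<le> 0" using v w Q by (simp add: lor_simps lor_commute[of w v])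
  then consider "future (v + w)" | "future (- (v + w))" using future_or_neg by blast
  then show "future (v + w)"
  proof cases
    \<comment> \<open>With a past sum, points of \<open>v\<close> cannot lie outside
      \<open>w\<close>, and disjointness keeps them out of its interior. So they lie on
      \<open>w\<close> and \<open>w\<close> is \<open>v\<close> or \<open>- v\<close>: the first
      contradicts the product -1, the second makes the sum 0, which is future.\<close>
    case 2
    have "circ_set v \<subseteq> circ_set w"
    proof
      fix z assume z: "z \<in> circ_set v"
      then have "lor v (null_pt z) = 0" by (simp add: circ_set_eq v)
      then show "z \<in> circ_set w"
        using lor_null_pt_le[OF 2, of z] disjoint_circ_int_boundary[OF v w disj z]
        by (simp add: circ_set_eq w lor_simps)
    qed
    then have "w = v \<or> w = - v" by (rule circ_set_subset_cases[OF v w])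
    then show ?thesis using Q v by (auto simp: future_def lor_simps)
  qed
qed

lemma lor_null_pts: "lor (null_pt y) (null_pt z) = - ((dist y z)\<^sup>2) / 2"
  unfolding dist_norm cmod_power2 by (simp add: lor_def power2_eq_square field_simps)

lemma future_disjoint:
  assumes "lor v v = 1" "lor w w = 1" "future (v + w)"
  shows "circ_int v \<inter> circ_int w = {}"
proof -
  have "\<not> (0 < lor v (null_pt z) \<and> 0 < lor w (null_pt z))" for z
    using lor_null_pt_le[OF assms(3), of z] by (simp add: lor_simps)
  then show ?thesis by (auto simp: circ_int_eq assms)
qed

lemma future_subset:
  assumes "lor v v = 1" "lor w w = 1" "future (v - w)"
  shows "circ_int v \<subseteq> circ_int w"
proof
  fix z assume "z \<in> circ_int v"
  then show "z \<in> circ_int w"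
    using lor_null_pt_le[OF assms(3), of z] by (simp add: circ_int_eq assms lor_simps)
qed

text \<open>The sum \<open>v + w\<close> is a nonzero null vector and represents the point of
  tangency. If its second coordinate is 0, this point is infinity and both circles are lines;
  otherwise it is a multiple of \<open>null_pt y\<close>, and products of distinct points of the
  plane are nonzero.\<close>

lemma tangent_if_lor:
  assumes v: "lor v v = 1" and w: "lor w w = 1" and Q: "lor v w = -1" and ne: "v + w \<noteq> 0"
  shows "tangent v w"
proof -
  define a where "a = v + w"
  have null: "lor a a = 0" using v w Q by (simp add: a_def lor_simps lor_commute[of w v])
  show ?thesis
  proof (cases "a$2 = 0")
    case True
    then have "a$3 * a$3 + a$4 * a$4 = 0" using null by (simp add: lor_def)
    then have a34: "a$3 = 0" "a$4 = 0" by (auto simp: sum_squares_eq_zero_iff)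
    then have a1: "a$1 \<noteq> 0" using ne True by (auto simp: a_def[symmetric] vec_eq_iff forall_4)
    have "lor v a = 0" using v Q by (simp add: a_def lor_simps)
    then have lines: "v$2 = 0" using True a34 a1 by (simp add: lor_def)
    moreover have "w$2 = 0" using True lines by (simp add: a_def)
    moreover have "circ_set v \<inter> circ_set w = {}"
    proof -
      have "lor a (null_pt z) \<noteq> 0" for z
        using True a34 a1 by (simp add: lor_def)
      then have "lor v (null_pt z) + lor w (null_pt z) \<noteq> 0" for z
        by (simp add: a_def lor_simps)
      then have "\<not> (lor v (null_pt z) = 0 \<and> lor w (null_pt z) = 0)" for z
        by (metis add_0)
      then show ?thesis by (auto simp: circ_set_eq v w)
    qed
    ultimately show ?thesis by (simp add: tangent_def acc_curv_def)
  next
    case False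
    define y where "y = Complex (a$3 / a$2) (a$4 / a$2)"
    have a1: "a$1 * a$2 = a$3 * a$3 + a$4 * a$4" using null by (simp add: lor_def)
    have "(a$3 / a$2)\<^sup>2 + (a$4 / a$2)\<^sup>2 = a$1 * a$2 / (a$2 * a$2)"
      unfolding a1 by (simp add: power2_eq_square add_divide_distrib)
    then have "a$1 = a$2 * ((a$3 / a$2)\<^sup>2 + (a$4 / a$2)\<^sup>2)"
      using False by simp
    then have a: "a = a$2 *\<^sub>R null_pt y"
      using False by (simp add: vec_eq_iff forall_4 y_def)
    have "a$2 * lor v (null_pt y) = lor v a"
      using arg_cong[OF a, of "lor v"] by (simp add: lor_simps)
    then have vy: "lor v (null_pt y) = 0" using False v Q by (simp add: a_def lor_simps)
    have "a$2 * lor w (null_pt y) = lor w a"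
      using arg_cong[OF a, of "lor w"] by (simp add: lor_simps)
    then have wy: "lor w (null_pt y) = 0"
      using False w Q by (simp add: a_def lor_simps lor_commute[of w v])
    have "z = y" if "lor v (null_pt z) = 0" "lor w (null_pt z) = 0" for z
    proof -
      have "lor a (null_pt z) = 0" using that by (simp add: a_def lor_simps)
      then have "a$2 * lor (null_pt y) (null_pt z) = 0"
        using arg_cong[OF a, of "\<lambda>u. lor u (null_pt z)"] by (simp add: lor_simps)
      then show ?thesis using False by (simp add: lor_null_pts)
    qed
    moreover have "\<not> (v$2 = 0 \<and> w$2 = 0)" using False by (auto simp: a_def)
    ultimately show ?thesis
      using vy wy by (auto simp: tangent_def acc_curv_def circ_set_eq v w)
  qed
qed

section \<open>Descartes configurations as systems of Lorentz vectors\<close>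

definition descartes :: "real^4^4 \<Rightarrow> bool" where
  "descartes W \<longleftrightarrow> (\<forall>i. lor (W$i) (W$i) = 1) \<and>
     (\<forall>i j. i \<noteq> j \<longrightarrow> lor (W$i) (W$j) = -1 \<and> future (W$i + W$j))"

text \<open>From here on the geometry of a configuration is read off from products and futurity. For
  the converse, a third row shows that the sum of two distinct rows is nonzero: its product with
  that sum is -2.\<close>

lemma pos_descartes_iff: "pos_descartes W \<longleftrightarrow> descartes W"
proof
  assume "pos_descartes W"
  then have 1: "lor (W$i) (W$i) = 1"
    and 2: "i \<noteq> j \<Longrightarrow> tangent (W$i) (W$j)" "i \<noteq> j \<Longrightarrow> circ_int (W$i) \<inter> circ_int (W$j) = {}" for i j
    by (simp_all add: pos_descartes_def valid_acc_iff)
  show "descartes W"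
    using 1 tangent_disjoint_lor[OF 1 1 2] by (simp add: descartes_def)
next
  assume W: "descartes W"
  have ne: "W$i + W$j \<noteq> 0" if "i \<noteq> j" for i j
  proof -
    have "\<exists>k. k \<noteq> i \<and> k \<noteq> j"
    proof -
      have "card {i, j} < CARD(4)" by (cases "i = j") simp_all
      then have "{i, j} \<noteq> UNIV" by force
      then show ?thesis by blast
    qed
    then obtain k where k: "k \<noteq> i" "k \<noteq> j" by blast
    then have "lor (W$i + W$j) (W$k) = -2" using W by (simp add: descartes_def lor_simps)
    then show ?thesis using lor_simps(9)[of "W$k"] by auto
  qed
  have 1: "lor (W$i) (W$i) = 1"
    and 2: "i \<noteq> j \<Longrightarrow> lor (W$i) (W$j) = -1" "i \<noteq> j \<Longrightarrow> future (W$i + W$j)" for i j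
    using W by (simp_all add: descartes_def)
  show "pos_descartes W"
    using 1 future_disjoint[OF 1 1 2(2)] tangent_if_lor[OF 1 1 2(1) ne]
    by (simp add: pos_descartes_def valid_acc_iff)
qed

section \<open>Orbits of configurations\<close>

text \<open>Applies one generator at a time, which allows induction along words. For involutive
  generators it agrees with the orbit of the group, by \<open>mat_group_orbit\<close>.\<close>

inductive_set orbit :: "(real^4^4) set \<Rightarrow> real^4^4 \<Rightarrow> (real^4^4) set" for G W where
  base: "W \<in> orbit G W"
| step: "V \<in> orbit G W \<Longrightarrow> g \<in> G \<Longrightarrow> g ** V \<in> orbit G W"

lemma orbit_trans: "X \<in> orbit G V \<Longrightarrow> V \<in> orbit G W \<Longrightarrow> X \<in> orbit G W"
  by (induction rule: orbit.induct) (auto intro: orbit.intros)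

lemma orbit_mono: "X \<in> orbit G W \<Longrightarrow> G \<subseteq> H \<Longrightarrow> X \<in> orbit H W"
  by (induction rule: orbit.induct) (auto intro: orbit.intros)

lemma orbit_sym:
  assumes "\<And>g. g \<in> G \<Longrightarrow> g ** g = mat 1" "V \<in> orbit G W" shows "W \<in> orbit G V"
  using assms(2)
proof (induction rule: orbit.induct)
  case (step V g)
  have "g ** (g ** V) \<in> orbit G (g ** V)" using step by (intro orbit.intros)
  then have "V \<in> orbit G (g ** V)" using assms(1)[OF step(2)] by (simp add: matrix_mul_assoc)
  then show ?case using step orbit_trans by blast
qed (rule orbit.base)

lemma countable_orbit:
  assumes "countable G" shows "countable (orbit G W)"
proof (rule countable_subset)
  show "orbit G W \<subseteq> (\<lambda>gs. foldr (**) gs W) ` lists G"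
  proof
    fix X assume "X \<in> orbit G W"
    then show "X \<in> (\<lambda>gs. foldr (**) gs W) ` lists G"
    proof (induction rule: orbit.induct)
      case base
      show ?case by (rule image_eqI[of _ _ "[]"]) auto
    next
      case (step V g)
      then obtain gs where "gs \<in> lists G" "V = foldr (**) gs W" by blast
      then show ?case using step by (intro image_eqI[of _ _ "g # gs"]) auto
    qed
  qed
qed (use assms in \<open>simp add: countable_lists\<close>)

lemma matrix_inv_eqI:
  fixes A B :: "real^'n^'n"
  assumes "A ** B = mat 1" shows "matrix_inv A = B"
proof -
  have "B ** A = mat 1" using assms by (simp add: matrix_left_right_inverse)
  then have "invertible A" using assms by (auto simp: invertible_def)
  then have "A ** matrix_inv A = mat 1 \<and> matrix_inv A ** A = mat 1"
    unfolding invertible_def matrix_inv_def by (rule someI_ex)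
  then show ?thesis using \<open>B ** A = mat 1\<close> by (metis matrix_mul_assoc matrix_mul_lid matrix_mul_rid)
qed

lemma mat_group_orbit:
  assumes inv: "\<And>g. g \<in> G \<Longrightarrow> g ** g = mat 1"
  shows "{U ** W | U. U \<in> mat_group G} = orbit G W"
proof (intro equalityI subsetI)
  fix X assume "X \<in> orbit G W"
  then show "X \<in> {U ** W | U. U \<in> mat_group G}"
  proof (induction rule: orbit.induct)
    case base
    then show ?case using mat_group.one by force
  next
    case (step V g)
    then show ?case by (force simp: matrix_mul_assoc intro: mat_group.mult mat_group.gen)
  qed
next
  \<comment> \<open>The claim carries an inverse \<open>U'\<close> that preserves the orbit too;
    otherwise the case of \<open>matrix_inv\<close> would not go through.\<close>
  have main: "\<exists>U'. U ** U' = mat 1 \<and> (\<forall>V \<in> orbit G W. U ** V \<in> orbit G W \<and> U' ** V \<in> orbit G W)"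
    if "U \<in> mat_group G" for U
    using that
  proof (induction rule: mat_group.induct)
    case one
    show ?case by (intro exI[of _ "mat 1"]) simp
  next
    case (gen g)
    then show ?case using inv by (intro exI[of _ g]) (simp add: orbit.step)
  next
    case (mult U V)
    then obtain U' V' where *: "U ** U' = mat 1" "V ** V' = mat 1"
      "\<forall>X \<in> orbit G W. U ** X \<in> orbit G W \<and> U' ** X \<in> orbit G W"
      "\<forall>X \<in> orbit G W. V ** X \<in> orbit G W \<and> V' ** X \<in> orbit G W" by blast
    have "U ** V ** (V' ** U') = U ** (V ** V') ** U'" by (simp only: matrix_mul_assoc)
    then have "U ** V ** (V' ** U') = mat 1" using * by simp
    then show ?case using *
      by (intro exI[of _ "V' ** U'"]) (simp add: matrix_mul_assoc[symmetric])
  next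
    case (inv U)
    then obtain U' where *: "U ** U' = mat 1"
      "\<forall>X \<in> orbit G W. U ** X \<in> orbit G W \<and> U' ** X \<in> orbit G W" by blast
    then show ?case
      by (intro exI[of _ U]) (simp add: matrix_inv_eqI[OF *(1)] matrix_left_right_inverse[of U' U])
  qed
  fix X assume "X \<in> {U ** W | U. U \<in> mat_group G}"
  then show "X \<in> orbit G W" using main orbit.base by fastforce
qed

section \<open>The generators as operations on the rows\<close>

definition row_sum :: "real^4^4 \<Rightarrow> real^4" where
  "row_sum W = (\<Sum>j\<in>UNIV. W$j)"

text \<open>Row \<open>i\<close> becomes twice the sum of the other rows minus itself, written with
  the full row sum. For a Descartes configuration this is the other circle tangent to the remaining
  three.\<close>

lemma S_mat_row:
  "(S_mat i ** W) $ r = (if r = i then 2 *\<^sub>R row_sum W - 3 *\<^sub>R W$i else W$r)"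
proof (cases "r = i")
  case True
  have "(S_mat i ** W) $ i $ c = 2 * (\<Sum>k\<in>UNIV. W$k$c) - 3 * W$i$c" for c
  proof -
    have "(S_mat i ** W) $ i $ c = (\<Sum>k\<in>UNIV. 2 * W$k$c - (if k = i then 3 * W$k$c else 0))"
      by (auto simp: matrix_matrix_mult_def S_mat_def intro!: sum.cong)
    then show ?thesis by (simp add: sum_subtractf sum_distrib_left)
  qed
  then show ?thesis using True by (simp add: vec_eq_iff row_sum_def)
next
  case False
  then show ?thesis
    by (simp add: vec_eq_iff matrix_matrix_mult_def S_mat_def if_distrib[of "\<lambda>x. x * _"] cong: if_cong)
qed

text \<open>On a Descartes configuration this is inversion in the \<open>i\<close>-th circle, that
  is, the reflection sending \<open>w\<close> to \<open>w\<close> minus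
  \<open>2 * lor w (W$i)\<close> times \<open>W$i\<close>.\<close>

lemma transpose_S_mat_row:
  "(transpose (S_mat i) ** W) $ r = (if r = i then - W$i else W$r + 2 *\<^sub>R W$i)"
proof -
  have "(transpose (S_mat i) ** W) $ r $ c = (if r = i then - W$i else W$r + 2 *\<^sub>R W$i) $ c" for c
  proof -
    have "(transpose (S_mat i) ** W) $ r $ c
      = (\<Sum>k\<in>UNIV. (if k = i then (if r = i then - W$i$c else 2 * W$i$c) else 0)
          + (if k = r then (if r = i then 0 else W$r$c) else 0))"
      unfolding matrix_matrix_mult_def transpose_def S_mat_def vec_lambda_beta
      by (rule sum.cong) auto
    then show ?thesis by (simp add: sum.distrib)
  qed
  then show ?thesis by (simp add: vec_eq_iff)
qed

lemma S_mat_involution: "S_mat i ** S_mat i = mat 1"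
  using exhaust_4[of i]
  by (elim disjE) (simp_all add: vec_eq_iff forall_4 matrix_matrix_mult_def sum_4 S_mat_def mat_def)

definition apollonian_gens :: "(real^4^4) set" where
  "apollonian_gens = range S_mat"

definition super_gens :: "(real^4^4) set" where
  "super_gens = range S_mat \<union> range (\<lambda>i. transpose (S_mat i))"

lemma apollonian_gens_involution: "g \<in> apollonian_gens \<Longrightarrow> g ** g = mat 1"
  by (auto simp: apollonian_gens_def S_mat_involution)

lemma super_gens_involution: "g \<in> super_gens \<Longrightarrow> g ** g = mat 1"
  by (auto simp: super_gens_def S_mat_involution matrix_transpose_mul[symmetric] transpose_mat)

lemma apollonian_gens_subset: "apollonian_gens \<subseteq> super_gens"
  by (auto simp: apollonian_gens_def super_gens_def)

lemma orbit_apollonian_gens: "orbit apollonian_gens W = {U ** W | U. U \<in> apollonian_group}"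
  unfolding apollonian_group_def apollonian_gens_def[symmetric]
  by (rule mat_group_orbit[symmetric]) (rule apollonian_gens_involution)

lemma orbit_super_gens: "orbit super_gens W = {U ** W | U. U \<in> super_apollonian_group}"
  unfolding super_apollonian_group_def super_gens_def[symmetric]
  by (rule mat_group_orbit[symmetric]) (rule super_gens_involution)

lemma packing_circles_eq: "packing_circles W = {circ_set (V $ i) | V i. V \<in> orbit apollonian_gens W}"
  unfolding packing_circles_def orbit_apollonian_gens by blast

lemma super_circles_eq: "super_circles W = {circ_set (V $ i) | V i. V \<in> orbit super_gens W}"
  unfolding super_circles_def orbit_super_gens by blast

lemma row_sum_add_delta: "(\<Sum>r\<in>UNIV. if r = i then a + (b r :: real^4) else b r) = a + sum b UNIV"
  for i :: 4
proof -
  have "(\<Sum>r\<in>UNIV. if r = i then a + b r else b r) = (\<Sum>r\<in>UNIV. (if r = i then a else 0) + b r)"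
    by (auto intro!: sum.cong)
  then show ?thesis by (simp add: sum.distrib)
qed

lemma row_sum_S_mat: "row_sum (S_mat i ** W) = 3 *\<^sub>R row_sum W - 4 *\<^sub>R W$i"
proof -
  have "row_sum (S_mat i ** W)
    = (\<Sum>r\<in>UNIV. if r = i then (2 *\<^sub>R row_sum W - 4 *\<^sub>R W$i) + W$r else W$r)"
    unfolding row_sum_def[of "S_mat i ** W"] S_mat_row
    by (auto intro!: sum.cong simp: vec_eq_iff)
  also have "\<dots> = (2 *\<^sub>R row_sum W - 4 *\<^sub>R W$i) + row_sum W"
    by (simp only: row_sum_add_delta row_sum_def)
  finally show ?thesis by (simp add: vec_eq_iff)
qed

context
  fixes W assumes W: "descartes W"
begin

lemma descartes_self [simp]: "lor (W$i) (W$i) = 1"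
  and descartes_diff: "i \<noteq> j \<Longrightarrow> lor (W$i) (W$j) = -1"
  and descartes_future: "i \<noteq> j \<Longrightarrow> future (W$i + W$j)"
  using W by (simp_all add: descartes_def)

lemma lor_row_sum: "lor (W$i) (row_sum W) = -2"
proof -
  have "lor (W$i) (row_sum W) = (\<Sum>j\<in>UNIV. lor (W$i) (W$j))"
    by (simp add: row_sum_def lor_sum_right)
  also have "\<dots> = (\<Sum>j\<in>UNIV. if j = i then 1 else -1)"
    using descartes_diff by (intro sum.cong) auto
  also have "\<dots> = (\<Sum>j\<in>UNIV. (if j = i then 2 else 0) + -1)"
    by (intro sum.cong) auto
  also have "\<dots> = -2"
    by (simp only: sum.distrib sum.delta finite_code) simp
  finally show ?thesis .
qed

lemma lor_row_sum_self: "lor (row_sum W) (row_sum W) = -8"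
proof -
  have "lor (row_sum W) (row_sum W) = (\<Sum>j\<in>UNIV. lor (row_sum W) (W$j))"
    by (subst (2) row_sum_def) (simp add: lor_sum_right)
  also have "\<dots> = (\<Sum>j\<in>(UNIV::4 set). -2)"
    by (intro sum.cong) (auto simp: lor_row_sum lor_commute[of "row_sum W"])
  finally show ?thesis by simp
qed

lemma future_row_sum: "future (row_sum W)"
proof -
  have "future ((W$1 + W$2) + (W$3 + W$4))"
    by (intro future_add descartes_future) simp_all
  then show ?thesis by (simp add: row_sum_def sum_4 add.assoc)
qed

text \<open>The products follow from those with the row sum. The new pair sums are null, and they
  are future because their product with the old row sum is negative; the same test serves for the
  transposes.\<close>

lemma descartes_S_mat: "descartes (S_mat i ** W)"
proof -
  define n where "n = 2 *\<^sub>R row_sum W - 3 *\<^sub>R W$i"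
  note lor = lor_simps lor_row_sum lor_row_sum_self lor_row_sum[unfolded lor_commute[of _ "row_sum W"]]
  have n: "lor n n = 1" by (simp add: n_def lor)
  have nr: "lor n (W$r) = -1" if "r \<noteq> i" for r
    using that by (simp add: n_def lor descartes_diff)
  have rn: "lor (W$r) n = -1" if "r \<noteq> i" for r
    using nr[OF that] by (simp add: lor_commute)
  have fut: "future (n + W$r)" if "r \<noteq> i" for r
  proof (rule future_if_lor_neg[OF _ future_row_sum])
    show "lor (n + W$r) (n + W$r) \<le> 0" using that by (simp add: lor_simps n nr rn)
    show "lor (n + W$r) (row_sum W) < 0" by (simp add: n_def lor)
  qed
  show ?thesis
    unfolding descartes_def S_mat_row
    using n nr rn fut descartes_diff descartes_future by (auto simp: n_def[symmetric] add.commute)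
qed

lemma descartes_transpose_S_mat: "descartes (transpose (S_mat i) ** W)"
proof -
  define n where "n r = W$r + 2 *\<^sub>R W$i" for r
  have n: "lor (n r) (n r) = 1" if "r \<noteq> i" for r
    using that by (simp add: n_def lor_simps descartes_diff)
  have nn: "lor (n r) (n s) = -1" if "r \<noteq> i" "s \<noteq> i" "r \<noteq> s" for r s
    using that by (simp add: n_def lor_simps descartes_diff)
  have ni: "lor (n r) (W$i) = 1" "lor (W$i) (n r) = 1" if "r \<noteq> i" for r
    using that by (simp_all add: n_def lor_simps descartes_diff)
  have fut: "future (n r + n s)" if "r \<noteq> i" "s \<noteq> i" "r \<noteq> s" for r s
  proof (rule future_if_lor_neg[OF _ future_row_sum])
    show "lor (n r + n s) (n r + n s) \<le> 0"
      using that nn[of r s] nn[of s r] by (simp add: lor_simps n)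
    show "lor (n r + n s) (row_sum W) < 0" by (simp add: n_def lor_simps lor_row_sum)
  qed
  have "future (n r - W$i)" if "r \<noteq> i" for r
  proof -
    have "n r - W$i = W$r + W$i" by (simp add: n_def vec_eq_iff)
    then show ?thesis using descartes_future[OF that] by (simp only:)
  qed
  then show ?thesis
    unfolding descartes_def transpose_S_mat_row
    using n nn ni fut by (auto simp: n_def[symmetric] lor_simps)
qed

end

lemma descartes_orbit: "V \<in> orbit super_gens W \<Longrightarrow> descartes W \<Longrightarrow> descartes V"
  by (induction rule: orbit.induct) (auto simp: super_gens_def descartes_S_mat descartes_transpose_S_mat)

text \<open>The integer combinations of the rows with odd coefficient sum.\<close>

inductive_set odd_span :: "real^4^4 \<Rightarrow> (real^4) set" for W where
  row: "W$i \<in> odd_span W"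
| neg: "a \<in> odd_span W \<Longrightarrow> - a \<in> odd_span W"
| add: "a \<in> odd_span W \<Longrightarrow> b \<in> odd_span W \<Longrightarrow> c \<in> odd_span W \<Longrightarrow> a + b + c \<in> odd_span W"

lemma odd_span_add2: "a \<in> odd_span W \<Longrightarrow> b \<in> odd_span W \<Longrightarrow> a + 2 *\<^sub>R b \<in> odd_span W"
  using odd_span.add[of a W b b] by (simp add: scaleR_2 add.assoc)

lemma odd_span_mono:
  assumes "\<And>i. V$i \<in> odd_span W" shows "odd_span V \<subseteq> odd_span W"
proof
  fix a assume "a \<in> odd_span V"
  then show "a \<in> odd_span W" by induction (auto intro: assms odd_span.intros)
qed

lemma odd_span_gens:
  assumes "g \<in> super_gens" shows "(g ** W) $ r \<in> odd_span W"
proof -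
  \<comment> \<open>A single row plus doubled members of the span; the coefficient -3 is split as 1
    - 2 - 2.\<close>
  have "2 *\<^sub>R row_sum W - 3 *\<^sub>R W$i
    = W$i + 2 *\<^sub>R W$1 + 2 *\<^sub>R W$2 + 2 *\<^sub>R W$3 + 2 *\<^sub>R W$4 + 2 *\<^sub>R (- W$i) + 2 *\<^sub>R (- W$i)" for i
    by (simp add: row_sum_def sum_4 vec_eq_iff)
  moreover have "W$i + 2 *\<^sub>R W$1 + 2 *\<^sub>R W$2 + 2 *\<^sub>R W$3 + 2 *\<^sub>R W$4 + 2 *\<^sub>R (- W$i) + 2 *\<^sub>R (- W$i)
    \<in> odd_span W" for i
    by (intro odd_span_add2 odd_span.row odd_span.neg)
  ultimately have "2 *\<^sub>R row_sum W - 3 *\<^sub>R W$i \<in> odd_span W" for i by simp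
  moreover have "- W$i \<in> odd_span W" "W$r + 2 *\<^sub>R W$i \<in> odd_span W" for i
    by (intro odd_span_add2 odd_span.row odd_span.neg)+
  ultimately show ?thesis
    using assms by (auto simp: super_gens_def S_mat_row transpose_S_mat_row odd_span.row)
qed

lemma odd_span_orbit_subset: "V \<in> orbit super_gens W \<Longrightarrow> odd_span V \<subseteq> odd_span W"
  by (induction rule: orbit.induct) (use odd_span_mono[OF odd_span_gens] in \<open>blast+\<close>)

lemma odd_span_orbit: "V \<in> orbit super_gens W \<Longrightarrow> odd_span V = odd_span W"
  using odd_span_orbit_subset orbit_sym[OF super_gens_involution] by blast

section \<open>Odd integrality of products and heights\<close>

definition odd_real :: "real \<Rightarrow> bool" where
  "odd_real x \<longleftrightarrow> (\<exists>n::int. odd n \<and> x = of_int n)"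

lemma odd_real_neg: "odd_real x \<Longrightarrow> odd_real (- x)"
  unfolding odd_real_def by (metis even_minus of_int_minus)

lemma odd_real_add: "odd_real x \<Longrightarrow> odd_real y \<Longrightarrow> odd_real z \<Longrightarrow> odd_real (x + y + z)"
  unfolding odd_real_def by (metis even_add of_int_add)

lemma odd_real_one: "odd_real 1" "odd_real (-1)"
  unfolding odd_real_def by (rule exI[of _ 1], simp) (rule exI[of _ "-1"], simp)

lemma odd_real_cases: "odd_real x \<Longrightarrow> x \<le> -1 \<or> 1 \<le> x"
proof -
  assume "odd_real x"
  then obtain n :: int where n: "odd n" "x = of_int n" by (auto simp: odd_real_def)
  then have "n \<le> -1 \<or> 1 \<le> n" by (cases "n = 0") auto
  then show ?thesis
    using of_int_le_iff[of n "-1", where ?'a = real] of_int_le_iff[of 1 n, where ?'a = real]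
    by (auto simp: n(2))
qed

text \<open>In the hyperboloid model \<open>row_sum W\<close> represents the center of the ideal octahedron of \<open>W\<close>;
  the height is positive iff this center lies outside of the oriented circle \<open>u\<close>.\<close>

definition height :: "real^4^4 \<Rightarrow> real^4 \<Rightarrow> real" where
  "height W u = - lor u (row_sum W) / 2"

lemma height_simps:
  "height W (u + v) = height W u + height W v" "height W (u - v) = height W u - height W v"
  "height W (- u) = - height W u"
  by (simp_all add: height_def lor_simps field_simps)

lemma height_row: "descartes W \<Longrightarrow> height W (W$i) = 1"
  by (simp add: height_def lor_row_sum)

lemma odd_height: "descartes W \<Longrightarrow> u \<in> odd_span W \<Longrightarrow> odd_real (height W u)"
  by (rotate_tac, induction rule: odd_span.induct)
     (auto simp: height_simps height_row odd_real_one intro: odd_real_neg odd_real_add)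

lemma odd_lor:
  assumes W: "descartes W" and u: "u \<in> odd_span W" and v: "v \<in> odd_span W"
  shows "odd_real (lor u v)"
proof -
  have row: "odd_real (lor a (W$i))" if "a \<in> odd_span W" for a i
    using that
  proof induction
    case (row j)
    then show ?case
      using W by (cases "j = i") (auto simp: descartes_diff odd_real_one)
  qed (auto simp: lor_simps intro: odd_real_neg odd_real_add)
  show ?thesis
    using v by induction (auto simp: lor_simps row u intro: odd_real_neg odd_real_add)
qed

section \<open>Sides of circles and nesting depth\<close>

lemma lor_future_height:
  assumes "descartes V" "future a" shows "0 \<le> height V a"
  using lor_future_le[OF assms(2) future_row_sum[OF assms(1)]] by (simp add: height_def)

lemma future_if_height_pos:
  assumes "descartes V" "lor a a \<le> 0" "0 < height V a" shows "future a"
  using future_if_lor_neg[OF assms(2) future_row_sum[OF assms(1)]] assms(3) by (simp add: height_def)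

lemma causal_height_zero:
  assumes "descartes V" "lor a a \<le> 0" "height V a = 0" shows "a = 0"
  using causal_orthogonal_timelike[OF assms(2), of "row_sum V"] lor_row_sum_self[OF assms(1)] assms(3)
  by (simp add: height_def)

lemma future_zero: "future 0"
  by (simp add: future_def lor_simps)

text \<open>The future cone is convex and contains no spacelike vector. This excludes incompatible
  pairs of nesting and disjointness relations.\<close>

lemma spacelike_not_future_sum:
  assumes "lor u u = 1" "future a" "future b" "a + b = 2 *\<^sub>R u" shows False
  using future_add[OF assms(2,3)] assms(1) unfolding assms(4) by (simp add: future_def lor_simps)

lemma circ_set_neg: "lor u u = 1 \<Longrightarrow> circ_set (- u) = circ_set u"
  by (simp add: circ_set_eq lor_simps)

text \<open>The bounds on \<open>2 * a\<close>, ..., \<open>2 * d\<close> say that replacing one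
  entry by twice the sum of the others minus itself does not lower the sum \<open>s\<close>. The
  quadratic relation reads \<open>a * (s - 2 * a) + ... + d * (s - 2 * d) = 8\<close> with
  nonnegative terms. Bounding \<open>a\<close>, \<open>b\<close>, \<open>c\<close> below by 1 gives
  \<open>s + 2 * d \<le> 8\<close>, which fails for \<open>d\<close> at least 3.\<close>

lemma descartes_quadruple_minimal:
  fixes a b c d :: real
  assumes "1 \<le> a" "1 \<le> b" "1 \<le> c" "1 \<le> d"
    and "2 * a \<le> a + b + c + d" "2 * b \<le> a + b + c + d" "2 * c \<le> a + b + c + d" "2 * d \<le> a + b + c + d"
    and q: "2 * (a\<^sup>2 + b\<^sup>2 + c\<^sup>2 + d\<^sup>2) - (a + b + c + d)\<^sup>2 = -8"
  shows "d < 3"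
proof (rule ccontr)
  assume "\<not> d < 3"
  define s where "s = a + b + c + d"
  have "a * (s - 2 * a) + b * (s - 2 * b) + c * (s - 2 * c) + d * (s - 2 * d) = 8"
    using q by (simp add: s_def power2_eq_square algebra_simps)
  moreover have le: "0 \<le> s - 2 * a" "0 \<le> s - 2 * b" "0 \<le> s - 2 * c" "0 \<le> s - 2 * d"
    using assms by (simp_all add: s_def)
  moreover have "0 \<le> d * (s - 2 * d)" using assms(4) le(4) by simp
  moreover note mult_right_mono[OF assms(1) le(1)] mult_right_mono[OF assms(2) le(2)]
    mult_right_mono[OF assms(3) le(3)]
  moreover have "x + y + z \<le> 8" if "p + q + r + t = 8" "0 \<le> t" "1 * x \<le> p" "1 * y \<le> q" "1 * z \<le> r"
    for p q r t x y z :: real using that by linarith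
  ultimately have "(s - 2 * a) + (s - 2 * b) + (s - 2 * c) \<le> 8" by blast
  then show False using assms(1-4) \<open>\<not> d < 3\<close> unfolding s_def by linarith
qed

locale super_packing =
  fixes W0 :: "real^4^4"
  assumes W0: "descartes W0"
begin

abbreviation orb :: "(real^4^4) set" where "orb \<equiv> orbit super_gens W0"

text \<open>Every circle of the super-packing occurs here with both orientations. The one of
  positive height in \<open>W0\<close> turns out to carry the interior
  \<open>sp_int\<close>.\<close>

definition rows :: "(real^4) set" where "rows = {V $ i | V i. V \<in> orb}"

lemma W0_orb: "W0 \<in> orb" by (rule orbit.base)

lemma orb_descartes: "V \<in> orb \<Longrightarrow> descartes V"
  using descartes_orbit W0 by blast

lemma orb_row: "V \<in> orb \<Longrightarrow> V $ i \<in> rows"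
  by (auto simp: rows_def)

lemma orb_apollonian: "V \<in> orb \<Longrightarrow> V' \<in> orbit apollonian_gens V \<Longrightarrow> V' \<in> orb"
  using orbit_trans orbit_mono[OF _ apollonian_gens_subset] by blast

lemma orb_S_mat: "V \<in> orb \<Longrightarrow> S_mat i ** V \<in> orb"
  and orb_transpose: "V \<in> orb \<Longrightarrow> transpose (S_mat i) ** V \<in> orb"
  by (auto intro: orbit.step simp: super_gens_def)

lemma rows_odd_span: "u \<in> rows \<Longrightarrow> V \<in> orb \<Longrightarrow> u \<in> odd_span V"
  unfolding rows_def by (auto simp: odd_span_orbit intro: odd_span_orbit[THEN equalityD1, THEN subsetD, OF _ odd_span.row])

lemma rows_self [simp]: "u \<in> rows \<Longrightarrow> lor u u = 1"
  unfolding rows_def using orb_descartes descartes_self by blast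

text \<open>Inverting a configuration in one of its own circles reverses that circle.\<close>

lemma rows_neg: "u \<in> rows \<Longrightarrow> - u \<in> rows"
proof -
  assume "u \<in> rows"
  then obtain V i where "V \<in> orb" "u = V $ i" by (auto simp: rows_def)
  then have "(transpose (S_mat i) ** V) $ i = - u" by (simp add: transpose_S_mat_row)
  then show ?thesis using orb_row[OF orb_transpose[OF \<open>V \<in> orb\<close>]] by metis
qed

lemma rows_height_cases: "u \<in> rows \<Longrightarrow> V \<in> orb \<Longrightarrow> height V u \<le> -1 \<or> 1 \<le> height V u"
  by (intro odd_real_cases odd_height orb_descartes rows_odd_span)

text \<open>The product is an odd integer, so \<open>u + v\<close> or \<open>u - v\<close> is
  causal; the heights fix the time direction. Equal heights in the second case force
  \<open>u = v\<close>.\<close>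

lemma nested_or_disjoint:
  assumes u: "u \<in> rows" and v: "v \<in> rows" and V: "V \<in> orb"
    and pos: "0 < height V v" "height V v \<le> height V u"
  shows "future (u + v) \<or> future (u - v)"
proof -
  have "lor u v \<le> -1 \<or> 1 \<le> lor u v"
    using u v V by (intro odd_real_cases odd_lor[of V] orb_descartes rows_odd_span)
  then show ?thesis
  proof
    assume le: "lor u v \<le> -1"
    have "future (u + v)"
      using u v le pos by (intro future_if_height_pos[OF orb_descartes[OF V]])
        (simp_all add: lor_simps height_simps lor_commute[of v u])
    then show ?thesis ..
  next
    assume ge: "1 \<le> lor u v"
    have c: "lor (u - v) (u - v) \<le> 0" using u v ge by (simp add: lor_simps lor_commute[of v u])
    have "future (u - v)"
    proof (cases "height V v = height V u")
      case True
      then have "u - v = 0" by (intro causal_height_zero[OF orb_descartes[OF V] c]) (simp add: height_simps)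
      then show ?thesis by (simp add: future_zero)
    next
      case False
      then show ?thesis
        using pos by (intro future_if_height_pos[OF orb_descartes[OF V] c]) (simp add: height_simps)
    qed
    then show ?thesis ..
  qed
qed

text \<open>The rows of a configuration have the least positive height, hence contain rather than
  are contained.\<close>

lemma row_comparable:
  assumes "u \<in> rows" "V \<in> orb" "0 < height V u"
  shows "future (u + V $ i) \<or> future (u - V $ i)"
  using assms rows_height_cases[of u V]
  by (intro nested_or_disjoint[of _ _ V]) (auto simp: orb_row height_row[OF orb_descartes])

text \<open>A circle separating two configurations that share a circle must be the shared one.
  Comparing \<open>u\<close> with it in \<open>V\<close>, and \<open>- u\<close> with it in
  \<open>V'\<close>, gives four combinations; two would make a spacelike vector future, one violates
  the heights, and the last yields \<open>u = V $ i\<close>.\<close>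

lemma shared_row_side:
  assumes V: "V \<in> orb" and V': "V' \<in> orb" and row: "V' $ j = V $ i \<or> V' $ j = - V $ i"
    and u: "u \<in> rows" "0 < height V u" "height V' u < 0"
  shows "u = V $ i \<and> V' $ j = - V $ i"
proof -
  define w where "w = V $ i"
  have w: "w \<in> rows" "height V w = 1" using V by (auto simp: w_def orb_row height_row[OF orb_descartes])
  have "future (u + w) \<or> future (u - w)"
    unfolding w_def by (rule row_comparable) (use assms in auto)
  moreover have "future (- u + w) \<or> future (- u - w)"
  proof -
    have "future (- u + V' $ j) \<or> future (- u - V' $ j)"
      using row_comparable[OF rows_neg[OF u(1)] V', of j] u(3) by (simp add: height_simps)
    then show ?thesis
      using row unfolding w_def[symmetric] by (metis add_uminus_conv_diff diff_minus_eq_add)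
  qed
  moreover have "\<not> (future (u + w) \<and> future (- u + w))"
    using spacelike_not_future_sum[of w "u + w" "- u + w"] w by (auto simp: scaleR_2)
  moreover have "\<not> (future (u - w) \<and> future (- u - w))"
    using spacelike_not_future_sum[of "- w" "u - w" "- u - w"] w by (auto simp: scaleR_2 lor_simps)
  moreover have "\<not> (future (u + w) \<and> future (- u - w))"
    using future_antisym[of "u + w"] u(2) w by (auto simp: height_simps add_eq_0_iff2)
  ultimately have "future (u - w)" "future (- u + w)" by blast+
  then have "u = w" using future_antisym[of "u - w"] by simp
  moreover have "V' $ j \<noteq> w"
    using u(3) height_row[OF orb_descartes[OF V'], of j] \<open>u = w\<close> by auto
  ultimately show ?thesis using row by (auto simp: w_def)
qed

text \<open>Some row survives with its orientation, whereas a circle changing sides would require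
  the shared row to be reversed.\<close>

lemma S_mat_same_side:
  assumes V: "V \<in> orb" and u: "u \<in> rows"
  shows "0 < height (S_mat i ** V) u \<longleftrightarrow> 0 < height V u"
proof -
  have "{i} \<noteq> UNIV" 
  proof
    assume "{i} = UNIV"
    then have "CARD(4) = card {i}" by (rule arg_cong[OF sym])
    then show False by simp
  qed
  then obtain j where j: "j \<noteq> i" by blast
  let ?V = "S_mat i ** V"
  have row: "?V $ j = V $ j" using j by (simp add: S_mat_row)
  have ne: "V $ j \<noteq> - V $ j"
  proof
    assume "V $ j = - V $ j"
    then have "V $ j = 0" by (simp add: vec_eq_iff)
    then show False using rows_self[OF orb_row[OF V, of j]] by (simp add: lor_simps)
  qed
  have "\<not> (0 < height V u \<and> height ?V u < 0)"
    using shared_row_side[OF V orb_S_mat[OF V] disjI1[OF row] u] row ne by auto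
  moreover have "\<not> (0 < height ?V u \<and> height V u < 0)"
    using shared_row_side[OF orb_S_mat[OF V] V disjI1[OF row[symmetric]] u] row ne by auto
  ultimately show ?thesis
    using rows_height_cases[OF u V] rows_height_cases[OF u orb_S_mat[OF V, of i]] by linarith
qed

lemma apollonian_same_side:
  assumes "V' \<in> orbit apollonian_gens V" and V: "V \<in> orb" and u: "u \<in> rows"
  shows "0 < height V' u \<longleftrightarrow> 0 < height V u"
  using assms(1)
proof induction
  case (step X g)
  then obtain i where "g = S_mat i" by (auto simp: apollonian_gens_def)
  then show ?case using step S_mat_same_side[OF orb_apollonian[OF V step(1)] u] by simp
qed simp

section \<open>Circles separating a configuration from the initial one\<close>

definition separating :: "real^4^4 \<Rightarrow> (real^4) set" where
  "separating V = {u \<in> rows. 0 < height W0 u \<and> height V u < 0}"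

lemma separating_apollonian:
  assumes "V' \<in> orbit apollonian_gens V" "V \<in> orb" shows "separating V' = separating V"
proof -
  have "height V' u < 0 \<longleftrightarrow> height V u < 0" if "u \<in> rows" for u
    using apollonian_same_side[OF assms that] rows_height_cases[OF that assms(2)]
      rows_height_cases[OF that orb_apollonian[OF assms(2,1)]] by auto
  then show ?thesis by (auto simp: separating_def)
qed

lemma transpose_side:
  assumes V: "V \<in> orb" and u: "u \<in> rows" "u \<noteq> V $ i" "u \<noteq> - V $ i"
  shows "height (transpose (S_mat i) ** V) u < 0 \<longleftrightarrow> height V u < 0"
proof -
  let ?V = "transpose (S_mat i) ** V"
  have row: "?V $ i = - V $ i" by (simp add: transpose_S_mat_row)
  have "\<not> (0 < height V u \<and> height ?V u < 0)"
    using shared_row_side[OF V orb_transpose[OF V] disjI2[OF row] u(1)] u by blast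
  moreover have row': "V $ i = - ?V $ i" using row by simp
  have "\<not> (0 < height ?V u \<and> height V u < 0)"
    using shared_row_side[OF orb_transpose[OF V] V disjI2[OF row'] u(1)] row u by auto
  ultimately show ?thesis
    using rows_height_cases[OF u(1) V] rows_height_cases[OF u(1) orb_transpose[OF V, of i]] by linarith
qed

text \<open>Along a word in the generators, an Apollonian step leaves the set unchanged and a dual
  step adds at most the two orientations of one circle.\<close>

lemma finite_separating: "V \<in> orb \<Longrightarrow> finite (separating V)"
proof (induction rule: orbit.induct)
  case base
  have "separating W0 = {}" by (auto simp: separating_def)
  then show ?case by simp
next
  case (step V g)
  consider i where "g = S_mat i" | i where "g = transpose (S_mat i)"
    using step(2) by (auto simp: super_gens_def)
  then show ?case
  proof cases
    case 1
    then have "g ** V \<in> orbit apollonian_gens V"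
      by (auto simp: apollonian_gens_def intro: orbit.intros)
    then show ?thesis using step separating_apollonian by simp
  next
    case 2
    have "separating (g ** V) \<subseteq> insert (V $ i) (insert (- V $ i) (separating V))"
      using transpose_side[OF step(1)] unfolding 2 by (auto simp: separating_def)
    then show ?thesis by (rule finite_subset) (use step(3) in simp)
  qed
qed

text \<open>Negative height means that row \<open>i\<close> has the center of \<open>W0\<close>
  inside, so its reverse separates. Inverting in it passes to the side of \<open>W0\<close> and
  removes exactly this one circle.\<close>

lemma separating_transpose:
  assumes V: "V \<in> orb" and neg: "height W0 (V $ i) < 0"
  shows "card (separating V) = Suc (card (separating (transpose (S_mat i) ** V)))"
proof -
  let ?V = "transpose (S_mat i) ** V"
  have row: "?V $ i = - V $ i" by (simp add: transpose_S_mat_row)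
  have "height ?V (- V $ i) = 1"
    using height_row[OF orb_descartes[OF orb_transpose[OF V, of i]], of i] row by simp
  then have notin: "- V $ i \<notin> separating ?V" by (simp add: separating_def)
  have "- V $ i \<in> separating V"
    using neg rows_neg[OF orb_row[OF V]] height_row[OF orb_descartes[OF V]] by (simp add: separating_def height_simps)
  moreover have "u \<in> separating V \<longleftrightarrow> u \<in> separating ?V" if "u \<noteq> - V $ i" for u
    using transpose_side[OF V _ _ that] neg by (cases "u = V $ i") (auto simp: separating_def)
  ultimately have "u \<in> separating V \<longleftrightarrow> u \<in> insert (- V $ i) (separating ?V)" for u
    by (cases "u = - V $ i") simp_all
  then have "separating V = insert (- V $ i) (separating ?V)" by (rule set_eqI)
  then show ?thesis using notin finite_separating[OF orb_transpose[OF V]] by simp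
qed

definition outer :: "real^4 \<Rightarrow> (real^4) set" where
  "outer u = {v \<in> rows. 0 < height W0 v \<and> v \<noteq> u \<and> future (u - v)}"

text \<open>Turns nesting around a row into separation of its configuration.
  \<open>row_comparable\<close> is applied to \<open>- v\<close> in one direction and to
  \<open>v\<close> in the other; heights and the properties of the cone exclude the unwanted
  alternatives.\<close>

lemma outer_eq_separating:
  assumes V: "V \<in> orb" and pos: "0 < height W0 (V $ i)"
  shows "outer (V $ i) = separating V"
proof -
  define w where "w = V $ i"
  have w: "w \<in> rows" "height V w = 1" using V by (auto simp: w_def orb_row height_row[OF orb_descartes])
  have "v \<in> outer w \<longleftrightarrow> v \<in> separating V" if v: "v \<in> rows" "0 < height W0 v" for v
  proof
    assume "v \<in> separating V"
    then have neg: "height V v < 0" by (simp add: separating_def)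
    then have "future (- v + w) \<or> future (- v - w)"
      using row_comparable[OF rows_neg[OF v(1)] V, of i] by (simp add: height_simps w_def)
    moreover have "\<not> future (- v - w)"
      using lor_future_height[OF W0, of "- v - w"] v pos by (auto simp: height_simps w_def)
    ultimately have "future (w - v)" by (simp add: add.commute)
    then show "v \<in> outer w" using v neg w by (auto simp: outer_def)
  next
    assume "v \<in> outer w"
    then have o: "v \<noteq> w" "future (w - v)" by (auto simp: outer_def)
    have "\<not> 0 < height V v"
    proof
      assume "0 < height V v"
      then have "future (v + w) \<or> future (v - w)"
        unfolding w_def by (rule row_comparable[OF v(1) V])
      then show False
        using spacelike_not_future_sum[of w "w - v" "v + w"] future_antisym[of "v - w"] o w
        by (auto simp: scaleR_2)
    qed
    then show "v \<in> separating V" using v rows_height_cases[OF v(1) V] by (auto simp: separating_def)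
  qed
  then show ?thesis unfolding w_def[symmetric] by (auto simp: outer_def separating_def)
qed

section \<open>Interiors and nesting depth of circles as point sets\<close>

lemma circ_set_inj:
  assumes "u \<in> rows" "v \<in> rows" "circ_set u \<subseteq> circ_set v" "0 < height W0 u" "0 < height W0 v"
  shows "u = v"
  using circ_set_subset_cases[of u v] assms by (auto simp: height_simps)

text \<open>All configurations of the packing of \<open>W0\<close> are on the outer side of
  \<open>u\<close>, so its circles miss \<open>circ_int u\<close>. This also identifies the
  complementary region as the wrong one.\<close>

lemma sp_int_eq:
  assumes u: "u \<in> rows" "0 < height W0 u"
  shows "sp_int W0 (circ_set u) = circ_int u"
  unfolding sp_int_def
proof (rule the_equality)
  have "circ_int u \<inter> circ_set (V $ i) = {}" if V: "V \<in> orbit apollonian_gens W0" for V i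
  proof -
    have V': "V \<in> orb" using orb_apollonian[OF W0_orb V] .
    have "future (u + V $ i) \<or> future (u - V $ i)"
      by (intro row_comparable u V') (use apollonian_same_side[OF V W0_orb u(1)] u in simp)
    then have "lor u (null_pt z) \<le> 0" if "z \<in> circ_set (V $ i)" for z
      using lor_null_pt_le[of "u + V $ i" z] lor_null_pt_le[of "u - V $ i" z] that
        circ_set_eq[OF rows_self[OF orb_row[OF V']]] by (auto simp: lor_simps)
    then show ?thesis using circ_int_eq[OF rows_self[OF u(1)]] by fastforce
  qed
  then show "(\<exists>w. valid_acc w \<and> circ_set w = circ_set u \<and> circ_int u = circ_int w) \<and>
      circ_int u \<inter> \<Union> (packing_circles W0) = {}"
    using u by (intro conjI exI[of _ u]) (auto simp: packing_circles_eq valid_acc_iff)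
next
  fix R assume "(\<exists>w. valid_acc w \<and> circ_set w = circ_set u \<and> R = circ_int w) \<and>
      R \<inter> \<Union> (packing_circles W0) = {}"
  then obtain w where w: "lor w w = 1" "circ_set w = circ_set u" "R = circ_int w"
    and disj: "R \<inter> \<Union> (packing_circles W0) = {}" by (auto simp: valid_acc_iff)
  have "w \<noteq> - u"
  proof
    assume wu: "w = - u"
    \<comment> \<open>If the reverse region missed the packing too, every circle of
      \<open>W0\<close> would lie on the circle \<open>u\<close>, making all rows equal.\<close>
    have "W0 $ i = u" for i
    proof (rule circ_set_inj)
      have "circ_set (W0 $ i) \<in> packing_circles W0" by (auto simp: packing_circles_eq intro: orbit.base)
      have ge: "0 \<le> lor u (null_pt z)" if "z \<in> circ_set (W0 $ i)" for z
      proof -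
        have "z \<notin> circ_int (- u)" using disj that \<open>circ_set (W0 $ i) \<in> _\<close> unfolding w wu by blast
        then show ?thesis using u by (simp add: circ_int_eq lor_simps)
      qed
      have "future (u + W0 $ i) \<or> future (u - W0 $ i)"
        by (rule row_comparable[OF u(1) W0_orb u(2)])
      then have le: "lor u (null_pt z) \<le> 0" if "z \<in> circ_set (W0 $ i)" for z
        using lor_null_pt_le[of "u + W0 $ i" z] lor_null_pt_le[of "u - W0 $ i" z] that
          circ_set_eq[OF rows_self[OF orb_row[OF W0_orb]]] by (auto simp: lor_simps)
      show "circ_set (W0 $ i) \<subseteq> circ_set u"
        using order_antisym[OF le ge] u by (auto simp: circ_set_eq[of u])
    qed (use u W0_orb W0 in \<open>simp_all add: orb_row height_row\<close>)
    then have "W0 $ 1 = W0 $ 2" by simp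
    then show False using descartes_diff[OF W0, of 1 2] descartes_self[OF W0, of 1] by simp
  qed
  then show "R = circ_int u"
    using circ_set_subset_cases[of w u] w u by auto
qed

lemma subset_closure_iff:
  assumes u: "u \<in> rows" "0 < height W0 u" and v: "v \<in> rows" "0 < height W0 v"
  shows "circ_set u \<subseteq> closure (circ_int v) \<longleftrightarrow> future (u - v)"
proof
  assume "future (u - v)"
  then have "closure (circ_int u) \<subseteq> closure (circ_int v)"
    using u v by (intro closure_mono future_subset) auto
  then show "circ_set u \<subseteq> closure (circ_int v)" using closure_circ_int[of u] u by auto
next
  assume sub: "circ_set u \<subseteq> closure (circ_int v)"
  show "future (u - v)"
  proof (rule ccontr)
    assume no: "\<not> future (u - v)"
    then have "future (v + u) \<or> future (v - u)"
      using nested_or_disjoint[OF u(1) v(1) W0_orb v(2)] nested_or_disjoint[OF v(1) u(1) W0_orb u(2)]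
        linear[of "height W0 u" "height W0 v"]
      by (auto simp: add.commute)
    \<comment> \<open>In the remaining relations no point of \<open>u\<close> is interior to
      \<open>v\<close>; lying in the closure then puts it on \<open>v\<close>, whence
      \<open>u = v\<close>.\<close>
    then have le: "lor v (null_pt z) \<le> 0" if "z \<in> circ_set u" for z
      using lor_null_pt_le[of "v + u" z] lor_null_pt_le[of "v - u" z] that u
      by (auto simp: lor_simps circ_set_eq)
    have "circ_set u \<subseteq> circ_set v"
    proof
      fix z assume z: "z \<in> circ_set u"
      then have "0 \<le> lor v (null_pt z)" using sub closure_circ_int_le[of v] v by auto
      then show "z \<in> circ_set v" using le[OF z] v by (simp add: circ_set_eq)
    qed
    then have "u = v" using circ_set_inj u v by blast
    then show False using no by (simp add: future_zero)
  qed
qed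

lemma super_circle_cases:
  assumes "C \<in> super_circles W0"
  obtains V i where "V \<in> orb" "C = circ_set (V $ i)" "0 < height W0 (V $ i)"
proof -
  obtain V i where V: "V \<in> orb" "C = circ_set (V $ i)" using assms by (auto simp: super_circles_eq)
  show ?thesis
  proof (cases "0 < height W0 (V $ i)")
    case True
    then show ?thesis using V that by blast
  next
    case False
    then have "height W0 (V $ i) < 0" using rows_height_cases[OF orb_row[OF V(1)] W0_orb, of i] by auto
    then show ?thesis
      using that[OF orb_transpose[OF V(1), of i], of i] V
      by (simp add: transpose_S_mat_row circ_set_neg orb_row height_simps)
  qed
qed

lemma super_circles_rows: "super_circles W0 = circ_set ` {u \<in> rows. 0 < height W0 u}"
proof (intro equalityI subsetI)
  fix C assume "C \<in> super_circles W0"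
  then show "C \<in> circ_set ` {u \<in> rows. 0 < height W0 u}"
    by (elim super_circle_cases) (auto simp: orb_row)
qed (auto simp: super_circles_eq rows_def)

lemma has_depth_iff:
  assumes V: "V \<in> orb" and pos: "0 < height W0 (V $ i)"
  shows "has_depth W0 (circ_set (V $ i)) k \<longleftrightarrow> card (separating V) = k"
proof -
  define u where "u = V $ i"
  have u: "u \<in> rows" "0 < height W0 u" using V pos by (auto simp: u_def orb_row)
  have "{C'. C' \<in> super_circles W0 \<and> C' \<noteq> circ_set u \<and> circ_set u \<subseteq> closure (sp_int W0 C')}
    = circ_set ` outer u"
  proof (intro equalityI subsetI)
    fix C assume "C \<in> circ_set ` outer u"
    then obtain v where v: "v \<in> rows" "0 < height W0 v" "v \<noteq> u" "future (u - v)" "C = circ_set v"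
      by (auto simp: outer_def)
    then show "C \<in> {C'. C' \<in> super_circles W0 \<and> C' \<noteq> circ_set u \<and> circ_set u \<subseteq> closure (sp_int W0 C')}"
      using u circ_set_inj[of v u] by (auto simp: super_circles_rows sp_int_eq subset_closure_iff[OF u, symmetric])
  next
    fix C assume "C \<in> {C'. C' \<in> super_circles W0 \<and> C' \<noteq> circ_set u \<and> circ_set u \<subseteq> closure (sp_int W0 C')}"
    then obtain v where "v \<in> rows" "0 < height W0 v" "C = circ_set v" "C \<noteq> circ_set u"
      "circ_set u \<subseteq> closure (sp_int W0 C)" by (auto simp: super_circles_rows)
    then show "C \<in> circ_set ` outer u"
      using subset_closure_iff[OF u] by (auto simp: sp_int_eq outer_def)
  qed
  moreover have "inj_on circ_set (outer u)"
    using circ_set_inj by (intro inj_onI) (auto simp: outer_def)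
  moreover have "outer u = separating V" unfolding u_def by (rule outer_eq_separating[OF V pos])
  ultimately show ?thesis
    using finite_separating[OF V] by (simp add: has_depth_def Let_def u_def[symmetric] card_image)
qed

end

section \<open>Packings and their bounding circles\<close>

lemma odd_real_Ints: "odd_real x \<Longrightarrow> x \<in> \<int>"
  by (auto simp: odd_real_def)

lemma odd_real_one_if_less_three:
  assumes "odd_real x" "1 \<le> x" "x < 3" shows "x = 1"
proof -
  obtain n :: int where n: "odd n" "x = of_int n" using assms(1) by (auto simp: odd_real_def)
  then have "1 \<le> n" "n < 3" using assms(2,3) by auto
  then have "n = 1 \<or> n = 2" by auto
  then show ?thesis using n by auto
qed

context super_packing
begin

section \<open>Existence of a bounding circle\<close>

definition total :: "real^4^4 \<Rightarrow> real" where
  "total V = height W0 (row_sum V)"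

lemma total_eq: "total V = (\<Sum>j\<in>UNIV. height W0 (V $ j))"
  by (simp add: total_def row_sum_def sum_4 height_simps)

lemma height_scale: "height W0 (c *\<^sub>R v) = c * height W0 v"
  by (simp add: height_def lor_simps)

text \<open>A Descartes relation for heights: both kinds of generators preserve the form, and at
  \<open>W0\<close> all heights are 1, so its value is 8 - 16.\<close>

lemma height_quadratic: "V \<in> orb \<Longrightarrow> 2 * (\<Sum>j\<in>UNIV. (height W0 (V $ j))\<^sup>2) - (total V)\<^sup>2 = -8"
proof (induction rule: orbit.induct)
  case base
  then show ?case by (simp add: total_eq height_row[OF W0])
next
  case (step V g)
  define t where "t j = height W0 (V $ j)" for j
  have IH: "2 * ((t 1)\<^sup>2 + (t 2)\<^sup>2 + (t 3)\<^sup>2 + (t 4)\<^sup>2) - (t 1 + t 2 + t 3 + t 4)\<^sup>2 = -8"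
    using step(3) by (simp add: total_eq sum_4 t_def)
  consider i where "g = S_mat i" | i where "g = transpose (S_mat i)"
    using step(2) by (auto simp: super_gens_def)
  then show ?case
  proof cases
    case 1
    have "height W0 ((g ** V) $ j) = (if j = i then 2 * (t 1 + t 2 + t 3 + t 4) - 3 * t i else t j)" for j
      by (simp add: 1 S_mat_row height_simps height_scale total_def[symmetric] total_eq sum_4 t_def)
    then show ?thesis using IH exhaust_4[of i]
      by (elim disjE) (simp_all add: total_eq sum_4 power2_eq_square algebra_simps)
  next
    case 2
    have "height W0 ((g ** V) $ j) = (if j = i then - t i else t j + 2 * t i)" for j
      by (simp add: 2 transpose_S_mat_row height_simps height_scale t_def)
    then show ?thesis using IH exhaust_4[of i]
      by (elim disjE) (simp_all add: total_eq sum_4 power2_eq_square algebra_simps)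
  qed
qed

lemma total_Ints: "V \<in> orb \<Longrightarrow> total V \<in> \<int>"
  unfolding total_eq using odd_height[OF W0 rows_odd_span[OF orb_row W0_orb]]
  by (intro Ints_sum odd_real_Ints) auto

lemma exists_bounding_row:
  assumes V: "V \<in> orb" and ne: "separating V \<noteq> {}"
  shows "\<exists>V' \<in> orbit apollonian_gens V. \<exists>i. height W0 (V' $ i) < 0"
proof (rule ccontr)
  assume no: "\<not> ?thesis"
  have pos: "1 \<le> height W0 (X $ i)" if "X \<in> orbit apollonian_gens V" for X i
  proof -
    have "\<not> height W0 (X $ i) < 0" using no that by blast
    then show ?thesis
      using rows_height_cases[OF orb_row[OF orb_apollonian[OF V that]] W0_orb, of i] by linarith
  qed
  have total: "total X = real (nat \<lfloor>total X\<rfloor>)" "4 \<le> total X" if "X \<in> orbit apollonian_gens V" for X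
  proof -
    show "4 \<le> total X"
      using pos[OF that, of 1] pos[OF that, of 2] pos[OF that, of 3] pos[OF that, of 4]
      by (simp add: total_eq sum_4)
    then show "total X = real (nat \<lfloor>total X\<rfloor>)"
      using total_Ints[OF orb_apollonian[OF V that]] by (auto elim!: Ints_cases)
  qed
  \<comment> \<open>The totals are integers bounded below by 4, so a minimal configuration exists;
    minimality against each \<open>S_mat i\<close> yields the bounds \<open>le\<close>.\<close>
  obtain X where X: "X \<in> orbit apollonian_gens V"
    and least: "\<And>Y. Y \<in> orbit apollonian_gens V \<Longrightarrow> nat \<lfloor>total X\<rfloor> \<le> nat \<lfloor>total Y\<rfloor>"
    using ex_has_least_nat[of "\<lambda>X. X \<in> orbit apollonian_gens V" V "\<lambda>X. nat \<lfloor>total X\<rfloor>"] orbit.base by blast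
  have Xo: "X \<in> orb" using orb_apollonian[OF V X] .
  define t where "t j = height W0 (X $ j)" for j
  have sum: "total X = t 1 + t 2 + t 3 + t 4" by (simp add: total_eq sum_4 t_def)
  have le: "2 * t i \<le> t 1 + t 2 + t 3 + t 4" for i
  proof -
    have Y: "S_mat i ** X \<in> orbit apollonian_gens V"
      using X by (auto simp: apollonian_gens_def intro: orbit.step)
    have "total X \<le> total (S_mat i ** X)"
      using least[OF Y] total(1)[OF X] total(1)[OF Y] by simp
    also have "\<dots> = 3 * total X - 4 * t i"
      by (simp add: total_def row_sum_S_mat height_simps height_scale t_def)
    finally show ?thesis using sum by simp
  qed
  have ge: "1 \<le> t i" for i using pos[OF X] by (simp add: t_def)
  have q: "2 * ((t 1)\<^sup>2 + (t 2)\<^sup>2 + (t 3)\<^sup>2 + (t 4)\<^sup>2) - (t 1 + t 2 + t 3 + t 4)\<^sup>2 = -8"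
    using height_quadratic[OF Xo] by (simp add: sum sum_4 t_def[symmetric])
  have "t 1 < 3"
    by (rule descartes_quadruple_minimal[of "t 2" "t 3" "t 4" "t 1"])
       (use ge le[of 1] le[of 2] le[of 3] le[of 4] q in \<open>simp_all add: ac_simps\<close>)
  moreover have "odd_real (t 1)"
    unfolding t_def by (intro odd_height W0 rows_odd_span orb_row Xo W0_orb)
  ultimately have t1: "t 1 = 1" using ge odd_real_one_if_less_three by blast
  \<comment> \<open>A separating circle has \<open>X $ 1\<close> inside it, so its height in
    \<open>W0\<close> is at most \<open>t 1 = 1\<close>, hence exactly 1. Then the causal difference
    has height 0, and \<open>u\<close> would be a row of \<open>X\<close>, of positive height
    there.\<close>
  obtain u where u: "u \<in> rows" "0 < height W0 u" "height X u < 0"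
    using ne separating_apollonian[OF X V] by (auto simp: separating_def)
  have "future (- u + X $ 1) \<or> future (- u - X $ 1)"
    using row_comparable[OF rows_neg[OF u(1)] Xo, of 1] u(3) by (simp add: height_simps)
  moreover have "\<not> future (- u - X $ 1)"
    using lor_future_height[OF W0, of "- u - X $ 1"] u(2) t1 by (auto simp: height_simps t_def)
  ultimately have fut: "future (X $ 1 - u)" by simp
  then have "height W0 (X $ 1 - u) = 0"
    using lor_future_height[OF W0 fut] t1 rows_height_cases[OF u(1) W0_orb] u(2)
    by (simp add: height_simps t_def)
  then have "X $ 1 - u = 0"
    using fut by (intro causal_height_zero[OF W0]) (auto simp: future_def)
  then have "u = X $ 1" by simp
  then show False using u(3) height_row[OF orb_descartes[OF Xo], of 1] by simp
qed

text \<open>Each of the two rows has positive height in the configuration of the other, so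
  \<open>row_comparable\<close> applies both ways; mutual containment means equality.\<close>

lemma bounding_row_comparable:
  assumes V: "V \<in> orb" and X: "X \<in> orbit apollonian_gens V" and Y: "Y \<in> orbit apollonian_gens V"
  shows "Y $ i = X $ j \<or> future (Y $ i + X $ j)"
proof -
  have X': "X \<in> orb" and Y': "Y \<in> orb" using orb_apollonian V X Y by blast+
  have pos: "0 < height Y (X $ j)" "0 < height X (Y $ i)"
    using apollonian_same_side[OF X V orb_row[OF X', of j]] apollonian_same_side[OF Y V orb_row[OF X', of j]]
      apollonian_same_side[OF X V orb_row[OF Y', of i]] apollonian_same_side[OF Y V orb_row[OF Y', of i]]
      height_row[OF orb_descartes[OF X'], of j] height_row[OF orb_descartes[OF Y'], of i] by simp_all
  have "future (Y $ i + X $ j) \<or> future (Y $ i - X $ j)"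
    by (rule row_comparable[OF orb_row[OF Y'] X' pos(2)])
  moreover have "future (X $ j + Y $ i) \<or> future (X $ j - Y $ i)"
    by (rule row_comparable[OF orb_row[OF X'] Y' pos(1)])
  ultimately show ?thesis
    using future_antisym[of "Y $ i - X $ j"] by (auto simp: add.commute)
qed

text \<open>Otherwise the sum of the two rows would be future, hence of nonnegative height: two
  circles with disjoint interiors cannot both have the center of \<open>W0\<close> inside.\<close>

lemma bounding_row_unique:
  assumes V: "V \<in> orb" and X: "X \<in> orbit apollonian_gens V" and Y: "Y \<in> orbit apollonian_gens V"
    and neg: "height W0 (X $ j) < 0" "height W0 (Y $ i) < 0"
  shows "Y $ i = X $ j"
  using bounding_row_comparable[OF V X Y, of i j] lor_future_height[OF W0, of "Y $ i + X $ j"] neg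
  by (auto simp: height_simps)

lemma bounding_circle_row:
  assumes V: "V \<in> orb" and X: "X \<in> orbit apollonian_gens V" and neg: "height W0 (X $ j) < 0"
  shows "bounding_circle W0 V (circ_set (X $ j))"
  unfolding bounding_circle_def
proof (intro conjI ballI)
  show "circ_set (X $ j) \<in> packing_circles V" using X by (auto simp: packing_circles_eq)
  \<comment> \<open>The interior induced by \<open>W0\<close> belongs to the reversed row, so
    disjointness from \<open>X $ j\<close> becomes containment in \<open>b\<close>.\<close>
  define b where "b = - X $ j"
  have X': "X \<in> orb" using orb_apollonian V X by blast
  have b: "b \<in> rows" "0 < height W0 b" "circ_set b = circ_set (X $ j)" "X $ j = - b"
    using rows_neg[OF orb_row[OF X']] neg by (auto simp: b_def height_simps circ_set_neg[OF rows_self[OF orb_row[OF X']]])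
  then have int: "sp_int W0 (circ_set (X $ j)) = circ_int b" using sp_int_eq[of b] by simp
  fix C assume "C \<in> packing_circles V"
  then obtain Y i where Y: "Y \<in> orbit apollonian_gens V" "C = circ_set (Y $ i)"
    by (auto simp: packing_circles_eq)
  define v where "v = Y $ i"
  have v: "v \<in> rows" using orb_apollonian V Y by (auto simp: v_def intro: orb_row)
  have "v = - b \<or> future (v - b)"
    using bounding_row_comparable[OF V X Y(1), of i j] by (simp add: v_def b(4))
  then have "circ_set v \<subseteq> closure (circ_int b)"
  proof
    assume "v = - b"
    then show ?thesis using b closure_circ_int[of b] by (simp add: circ_set_neg)
  next
    assume "future (v - b)"
    then have "closure (circ_int v) \<subseteq> closure (circ_int b)"
      using v b by (intro closure_mono future_subset) auto
    then show ?thesis using closure_circ_int[of v] v by auto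
  qed
  then show "C \<subseteq> closure (sp_int W0 (circ_set (X $ j)))" by (simp add: int Y(2) v_def)
qed

lemma has_depth_packing:
  assumes V: "V \<in> orb" and X: "X \<in> orbit apollonian_gens V" and neg: "height W0 (X $ j) < 0"
  shows "has_depth W0 (circ_set (X $ j)) (card (separating V) - 1)"
    and "packing_circles V - {circ_set (X $ j)}
      = {circ_set (Y $ i) | Y i. Y \<in> orbit apollonian_gens V \<and> 0 < height W0 (Y $ i)}"
proof -
  have X': "X \<in> orb" using orb_apollonian V X by blast
  \<comment> \<open>Inversion in the bounding circle gives a configuration that contains it with
    positive height and has one separating circle fewer.\<close>
  let ?X = "transpose (S_mat j) ** X"
  have row: "?X $ j = - X $ j" by (simp add: transpose_S_mat_row)
  have "has_depth W0 (circ_set (?X $ j)) (card (separating ?X))"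
    using neg by (intro has_depth_iff[THEN iffD2] orb_transpose X' refl) (simp add: row height_simps)
  then show "has_depth W0 (circ_set (X $ j)) (card (separating V) - 1)"
    using separating_transpose[OF X' neg] separating_apollonian[OF X V] row
    by (simp add: circ_set_neg[OF rows_self[OF orb_row[OF X']]])
  show "packing_circles V - {circ_set (X $ j)}
      = {circ_set (Y $ i) | Y i. Y \<in> orbit apollonian_gens V \<and> 0 < height W0 (Y $ i)}" (is "_ = ?R")
  proof (intro equalityI subsetI)
    fix C assume C: "C \<in> packing_circles V - {circ_set (X $ j)}"
    then obtain Y i where Y: "Y \<in> orbit apollonian_gens V" "C = circ_set (Y $ i)"
      by (auto simp: packing_circles_eq)
    have "\<not> height W0 (Y $ i) < 0"
      using bounding_row_unique[OF V X Y(1) neg, of i] Y C by auto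
    then show "C \<in> ?R"
      using rows_height_cases[OF orb_row[OF orb_apollonian[OF V Y(1)]] W0_orb, of i] Y by force
  next
    fix C assume "C \<in> ?R"
    then obtain Y i where Y: "Y \<in> orbit apollonian_gens V" "C = circ_set (Y $ i)" "0 < height W0 (Y $ i)"
      by blast
    have Y': "Y \<in> orb" using orb_apollonian V Y by blast
    have "C \<noteq> circ_set (X $ j)"
    proof
      assume "C = circ_set (X $ j)"
      then have "circ_set (X $ j) \<subseteq> circ_set (Y $ i)" using Y by simp
      then have "Y $ i = X $ j \<or> Y $ i = - X $ j"
        by (rule circ_set_subset_cases[OF rows_self[OF orb_row[OF X']] rows_self[OF orb_row[OF Y']]])
      then have "Y $ i = - X $ j" using Y neg by auto
      \<comment> \<open>The reverse of \<open>X $ j\<close> cannot occur in the same packing: its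
        height in \<open>X\<close> is -1, while every row of the packing has positive height
        there.\<close>
      moreover have "0 < height X (Y $ i)"
        using apollonian_same_side[OF X V orb_row[OF Y', of i]] apollonian_same_side[OF Y(1) V orb_row[OF Y', of i]]
          height_row[OF orb_descartes[OF Y'], of i] by simp
      ultimately show False
        using height_row[OF orb_descartes[OF X'], of j] by (simp add: height_simps)
    qed
    then show "C \<in> packing_circles V - {circ_set (X $ j)}"
      using Y by (auto simp: packing_circles_eq)
  qed
qed

section \<open>Circles of equal depth and their decomposition into packings\<close>

lemma depth_disjoint:
  assumes C: "C \<in> super_circles W0" "has_depth W0 C k"
    and C': "C' \<in> super_circles W0" "has_depth W0 C' k" and ne: "C \<noteq> C'"
  shows "sp_int W0 C \<inter> sp_int W0 C' = {}"
proof -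
  obtain V i where V: "V \<in> orb" "C = circ_set (V $ i)" "0 < height W0 (V $ i)"
    using super_circle_cases[OF C(1)] .
  obtain V' i' where V': "V' \<in> orb" "C' = circ_set (V' $ i')" "0 < height W0 (V' $ i')"
    using super_circle_cases[OF C'(1)] .
  define u where "u = V $ i"
  define v where "v = V' $ i'"
  have u: "u \<in> rows" "0 < height W0 u" and v: "v \<in> rows" "0 < height W0 v"
    using V V' by (auto simp: u_def v_def orb_row)
  have uv: "u \<noteq> v" using ne V V' by (auto simp: u_def v_def)
  have fin: "finite (outer u)" "finite (outer v)" and card: "card (outer u) = k" "card (outer v) = k"
    using C(2) C'(2) V V' by (simp_all add: u_def v_def outer_eq_separating has_depth_iff finite_separating)
  \<comment> \<open>If \<open>a\<close> is nested in \<open>b\<close>, everything around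
    \<open>b\<close> is also around \<open>a\<close>, and \<open>b\<close> itself is added, so the
    counts differ.\<close>
  have not_nested: False if ab: "a \<in> rows" "b \<in> rows" "0 < height W0 b" "a \<noteq> b" "future (a - b)"
    "finite (outer a)" "card (outer a) = card (outer b)" for a b
  proof -
    have "c \<in> outer a" if "c \<in> outer b" for c
    proof -
      have c: "c \<in> rows" "0 < height W0 c" "c \<noteq> b" "future (b - c)" using that by (auto simp: outer_def)
      have "future (a - c)" using future_add[OF ab(5) c(4)] by simp
      moreover have "c \<noteq> a" using c(4) ab(4,5) future_antisym[of "a - b"] by auto
      ultimately show ?thesis using c by (simp add: outer_def)
    qed
    moreover have "b \<in> outer a" "b \<notin> outer b" using ab by (auto simp: outer_def)
    ultimately have "outer b \<subset> outer a" by blast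
    then show False using psubset_card_mono[OF ab(6), of "outer b"] ab(7) by simp
  qed
  have "future (u + v) \<or> future (u - v) \<or> future (v - u)"
    using nested_or_disjoint[OF u(1) v(1) W0_orb v(2)] nested_or_disjoint[OF v(1) u(1) W0_orb u(2)]
      linear[of "height W0 u" "height W0 v"] by (auto simp: add.commute)
  then have "future (u + v)"
    using not_nested[of u v] not_nested[of v u] u v uv fin card by auto
  then show ?thesis
    using future_disjoint[of u v] u v sp_int_eq[OF u] sp_int_eq[OF v] V V' by (simp add: u_def v_def)
qed

lemma depth_packings:
  assumes k: "1 \<le> k"
  shows "\<exists>F. countable F \<and> \<Union>F = {C \<in> super_circles W0. has_depth W0 C k} \<and>
    (\<forall>P \<in> F. \<exists>W B. pos_descartes W \<and> packing_circles W \<subseteq> super_circles W0 \<and>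
       bounding_circle W0 W B \<and> P = packing_circles W - {B} \<and> has_depth W0 B (k - 1))"
proof -
  \<comment> \<open>The pair \<open>X\<close>, \<open>j\<close> only witnesses the bounding row of
    the packing of \<open>V\<close>; indexing by configurations of the countable orbit gives
    countability.\<close>
  define F where "F = {packing_circles V - {circ_set (X $ j)} | V X j. V \<in> orb \<and> card (separating V) = k \<and>
    X \<in> orbit apollonian_gens V \<and> height W0 (X $ j) < 0}"
  have "F \<subseteq> (\<lambda>(V, X, j). packing_circles V - {circ_set (X $ j)}) ` (orb \<times> orb \<times> UNIV)"
  proof
    fix P assume "P \<in> F"
    then obtain V X j where "V \<in> orb" "X \<in> orb" "P = packing_circles V - {circ_set (X $ j)}"
      unfolding F_def using orb_apollonian by blast
    then show "P \<in> (\<lambda>(V, X, j). packing_circles V - {circ_set (X $ j)}) ` (orb \<times> orb \<times> UNIV)"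
      by (intro image_eqI[of _ _ "(V, X, j)"]) auto
  qed
  moreover have "countable orb"
    by (intro countable_orbit countable_finite) (simp add: super_gens_def)
  ultimately have "countable F"
    by (elim countable_subset) (intro countable_image countable_SIGMA, auto)
  moreover have "\<Union>F = {C \<in> super_circles W0. has_depth W0 C k}"
  proof (intro equalityI subsetI)
    fix C assume "C \<in> \<Union>F"
    then obtain V X j where V: "V \<in> orb" "card (separating V) = k" "X \<in> orbit apollonian_gens V"
      "height W0 (X $ j) < 0" "C \<in> packing_circles V - {circ_set (X $ j)}" by (auto simp: F_def)
    then obtain Y i where Y: "Y \<in> orbit apollonian_gens V" "0 < height W0 (Y $ i)" "C = circ_set (Y $ i)"
      using has_depth_packing(2)[OF V(1,3,4)] by auto
    have Y': "Y \<in> orb" using orb_apollonian V Y by blast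
    then show "C \<in> {C \<in> super_circles W0. has_depth W0 C k}"
      using has_depth_iff[OF Y' Y(2)] separating_apollonian[OF Y(1) V(1)] V(2) Y(3)
      by (auto simp: super_circles_eq)
  next
    fix C assume "C \<in> {C \<in> super_circles W0. has_depth W0 C k}"
    then have C: "C \<in> super_circles W0" "has_depth W0 C k" by auto
    obtain V i where V: "V \<in> orb" "C = circ_set (V $ i)" "0 < height W0 (V $ i)"
      using super_circle_cases[OF C(1)] .
    have card: "card (separating V) = k" using has_depth_iff[OF V(1,3)] C(2) V(2) by simp
    \<comment> \<open>Here \<open>k \<ge> 1\<close> enters: some circle separates \<open>V\<close>
      from \<open>W0\<close>, so its packing has a bounding row.\<close>
    then have "separating V \<noteq> {}" using k by auto
    then obtain X j where X: "X \<in> orbit apollonian_gens V" "height W0 (X $ j) < 0"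
      using exists_bounding_row[OF V(1)] by blast
    have "C \<in> packing_circles V - {circ_set (X $ j)}"
      unfolding has_depth_packing(2)[OF V(1) X] using V orbit.base by blast
    then show "C \<in> \<Union>F" using V(1) card X unfolding F_def by blast
  qed
  moreover have "\<exists>W B. pos_descartes W \<and> packing_circles W \<subseteq> super_circles W0 \<and>
       bounding_circle W0 W B \<and> P = packing_circles W - {B} \<and> has_depth W0 B (k - 1)" if P: "P \<in> F" for P
  proof -
    obtain V X j where V: "V \<in> orb" "card (separating V) = k" "X \<in> orbit apollonian_gens V"
      "height W0 (X $ j) < 0" "P = packing_circles V - {circ_set (X $ j)}"
      using P by (auto simp: F_def)
    have "packing_circles V \<subseteq> super_circles W0"
      unfolding packing_circles_eq super_circles_eq using orb_apollonian[OF V(1)] by blast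
    then show ?thesis
      using V bounding_circle_row[OF V(1,3,4)] has_depth_packing(1)[OF V(1,3,4)] orb_descartes[OF V(1)]
      by (auto simp: pos_descartes_iff)
  qed
  ultimately show ?thesis by (intro exI[of _ F] conjI ballI)
qed

end

theorem theorem3p2:
  fixes W0 :: "real^4^4" and k :: nat
  assumes "pos_descartes W0" and "1 \<le> k"
  shows "pairwise (\<lambda>C C'. sp_int W0 C \<inter> sp_int W0 C' = {})
            {C \<in> super_circles W0. has_depth W0 C k}
       \<and> (\<exists>F. countable F \<and> \<Union>F = {C \<in> super_circles W0. has_depth W0 C k} \<and>
            (\<forall>P \<in> F. \<exists>W B. pos_descartes W \<and> packing_circles W \<subseteq> super_circles W0 \<and>
                 bounding_circle W0 W B \<and> P = packing_circles W - {B} \<and>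
                 has_depth W0 B (k - 1)))"
proof -
  interpret super_packing W0
    using assms(1) by unfold_locales (simp add: pos_descartes_iff)
  show ?thesis
    by (intro conjI depth_packings assms(2) pairwiseI depth_disjoint[where k = k]) simp_all
qed

end
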